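(* Consider the system $x_{k+1}=A_kx_k+B_ku_k+w_k$, $y_k=C_kx_k+v_k$ with the Kalman filter $\hat x_{k+1}=A_k\hat x_k+B_ku_k+K_k(y_k-C_k\hat x_k)$, as described in the context. Suppose $h:\mathbb{R}^n\to\mathbb{R}$ satisfies: (i) $h$ is twice continuously differentiable; (ii) there is $\lambda_{\max}>0$ such that $\sup_{x\in\mathbb{R}^n}\|\nabla^2h(x)\|_2\le\lambda_{\max}$; (iii) $h(x)\le M$ for all $x\in\mathbb{R}^n$, where $M>0$. Given an initial state $x_0$, a nominal controller $\hat{\mathbf u}_{0:T-1}=\hat u_0\hat u_1\cdots\hat u_{T-1}$ for a finite horizon $T\in\mathbb{N}$, and $\hat h:\mathbb{R}^n\to\mathbb{R}$, $\hat h(x)=h(x)-h_\gamma$, as defined in the context, the controller $$\mathbf u^*_{0:T-1}=\operatorname*{arg\,min}_{u_k\in\mathbb{R}^m}\ \sum_{k=0}^{T-1}\|u_k-\hat u_k\|_2^2$$ subject to (with $k$ the time index) $$\hat h(A_k\hat x_k+B_ku_k)-c_J'\ \ge\ \alpha\,\hat h(\hat x_k),$$ $$0\le c_J'\le (M-h_\gamma)(1-\alpha)+\tfrac{\lambda_{\max}}{2}\mathrm{tr}\big(K_k\,\mathrm{cov}[v_k]\,K_k^\top\big)+\tfrac{\lambda_{\max}}{2}\mathrm{tr}\big(K_kC_kP_kC_k^\top K_k^\top\big),$$ $$0<\alpha<1,$$ makes the following hold: $$P_s(\xi(x_0,\mathbf u^*_{0:T-1}))\ \ge\ 1-P_e^{\hat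 x}-\sigma,$$ where $P_e^{\hat x}$ satisfies: - if $\delta'<0$, $$P_e^{\hat x}\le\left(\frac{M-h_\gamma-\hat h(\hat x_0)}{M-h_\gamma}\right)\alpha^T+\frac{(M-h_\gamma)(1-\alpha)-\delta'}{M-h_\gamma}\sum_{i=1}^T\alpha^{i-1};$$ - if $\delta'\ge0$, $$P_e^{\hat x}\le 1-\frac{\hat h(\hat x_0)}{M-h_\gamma}\left(\frac{(M-h_\gamma)\alpha+\delta'}{M-h_\gamma}\right)^T,$$ with $\delta'$ satisfying $$\delta'\le c_J'-\tfrac{\lambda_{\max}}{2}\mathrm{tr}\big(K_k\,\mathrm{cov}[v_k]\,K_k^\top\big)-\tfrac{\lambda_{\max}}{2}\mathrm{tr}\big(K_kC_kP_kC_k^\top K_k^\top\big).$$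
   Context: System: $x_k\in\mathbb{R}^n$ is the state, $u_k\in\mathbb{R}^m$ the input, $y_k\in\mathbb{R}^{n_y}$ the measurement, $w_k$ the disturbance and $v_k$ the measurement noise (of compatible dimensions); $A_k,B_k,C_k$ are matrices of compatible sizes. The disturbances $w_k$ and measurement noises $v_k$ are mutually independent zero-mean Gaussian white-noise processes with finite second moments. Controllers are output-feedback: $u_k=\pi_k(y_0,\dots,y_k,\hat u_0,\dots,\hat u_k)$. The trajectory generated from $x_0$ under $\mathbf u_{0:T-1}=u_0\cdots u_{T-1}$ is denoted $\xi(x_0,\mathbf u_{0:T-1})=x_0x_1\cdots x_T$. Kalman filter (one-step predictor): $\hat x_k=\mathbb{E}[x_k\mid y_0,\dots,y_{k-1}]$, with gain $K_k=A_kP_kC_k^\top(C_kP_kC_k^\top+R_k)^{-1}$ and prediction error covariance $P_k$ given by $P_{k+1}=A_kP_kA_k^\top+Q_k-A_kP_kC_k^\top(C_kP_kC_k^\top+R_k)^{-1}C_kP_kA_k^\top$, $P_0=\mathbb{E}[(x_0-\hat x_0)(x_0-\hat x_0)^\top]$, $Q_k=\mathbb{E}[w_kw_k^\top]$, $R_k=\mathbb{E}[v_kv_k^\top]$. Safety: the system is safe at time $k$ iff $h(x_k)\ge0$. The safety probability is $P_s(\xi(x_0,\mathbf u_{0:T-1}))=1-\mathbb{P}\big[\min_{k\in\{0,\dots,T\}}h(x_k)<0\big]$. Here $\sigma>0$, and $\gamma>0$ is a constant associated with $\sigma$ such that $\mathbb{P}\big[\sup_{0\le k\le T}\|x_k-\hat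 x_k\|_2\le\gamma\big]\ge1-\sigma$. Define $$h_\gamma=\sup\{h(x):\ \|x-x^0\|\le\gamma\ \text{for some }x^0\in h^{-1}(\{0\})\},\qquad \hat h(x)=h(x)-h_\gamma,$$ and $P_e^{\hat x}=\mathbb{P}\big[\min_{k\in\{0,\dots,T\}}\hat h(\hat x_k)<0\big]$ under the controller considered.
   Formalization: Added: û_k and u*_k depend only on y_0..y_{k-1} (the P_e bound fails if they may use y_k); a.s. no x̂_k is a zero of ĥ at distance <γ from h^{-1}(0) (else the P_s bound can fail); x_0 is Gaussian and independent of the noises; h has a zero, h_γ<M, and C_kP_kC_k^T+R_k is invertible. *)

theory Defs
  imports "HOL-Probability.Probability"
begin

definition gradient :: "(real^'n \<Rightarrow> real) \<Rightarrow> real^'n \<Rightarrow> real^'n" where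
  "gradient h x = (\<chi> i. frechet_derivative h (at x) (axis i 1))"

definition hessian :: "(real^'n \<Rightarrow> real) \<Rightarrow> real^'n \<Rightarrow> real^'n^'n" where
  "hessian h x = jacobian (gradient h) (at x)"

definition twice_continuously_differentiable :: "(real^'n \<Rightarrow> real) \<Rightarrow> bool" where
  "twice_continuously_differentiable h \<longleftrightarrow>
     (\<forall>x. h differentiable (at x)) \<and> (\<forall>x. gradient h differentiable (at x)) \<and>
     continuous_on UNIV (hessian h)"

definition spectral_norm :: "real^'n^'m \<Rightarrow> real" where
  "spectral_norm A = onorm (\<lambda>v. A *v v)"

text \<open>A random vector is Gaussian iff all its one-dimensional projections are normal. The case
  \<open>s = 0\<close> is the Dirac distribution, so singular covariances and constant vectors are included.\<close>

definition gaussian_vector :: "'a measure \<Rightarrow> ('a \<Rightarrow> real^'n) \<Rightarrow> bool" where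
  "gaussian_vector \<Omega> X \<longleftrightarrow> X \<in> borel_measurable \<Omega> \<and>
     (\<forall>a. \<exists>m s. s \<ge> 0 \<and>
        distr \<Omega> borel (\<lambda>\<omega>. a \<bullet> X \<omega>) =
          (if s = 0 then return borel m else density lborel (\<lambda>t. ennreal (normal_density m s t))))"

definition outer :: "real^'n \<Rightarrow> real^'n^'n" where
  "outer a = (\<chi> i j. a $ i * a $ j)"

definition second_moment :: "'a measure \<Rightarrow> ('a \<Rightarrow> real^'n) \<Rightarrow> real^'n^'n" where
  "second_moment \<Omega> X = (LINT \<omega>|\<Omega>. outer (X \<omega>))"

definition cov :: "'a measure \<Rightarrow> ('a \<Rightarrow> real^'n) \<Rightarrow> real^'n^'n" where
  "cov \<Omega> X = second_moment \<Omega> (\<lambda>\<omega>. X \<omega> - (LINT \<omega>'|\<Omega>. X \<omega>'))"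

text \<open>Index set for the family consisting of the initial state, all disturbances and all
  measurement noises. The members live in different spaces, hence independence is expressed
  through the generated sigma-algebras.\<close>

datatype source = Initial | Disturbance nat | Noise nat

fun source_events ::
  "'a measure \<Rightarrow> ('a \<Rightarrow> real^'n) \<Rightarrow> (nat \<Rightarrow> 'a \<Rightarrow> real^'n) \<Rightarrow> (nat \<Rightarrow> 'a \<Rightarrow> real^'p)
     \<Rightarrow> source \<Rightarrow> 'a set set" where
  "source_events \<Omega> x0 w v Initial = sets (vimage_algebra (space \<Omega>) x0 borel)"
| "source_events \<Omega> x0 w v (Disturbance k) = sets (vimage_algebra (space \<Omega>) (w k) borel)"
| "source_events \<Omega> x0 w v (Noise k) = sets (vimage_algebra (space \<Omega>) (v k) borel)"

text \<open>The sigma-algebra generated by \<open>y\<^sub>0, \<dots>, y\<^sub>k\<^sub>-\<^sub>1\<close>; it is trivial for \<open>k = 0\<close>.\<close>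

definition past_measurements :: "'a measure \<Rightarrow> (nat \<Rightarrow> 'a \<Rightarrow> real^'p) \<Rightarrow> nat \<Rightarrow> 'a measure" where
  "past_measurements \<Omega> y k = sigma (space \<Omega>) (\<Union>i<k. {y i -` E \<inter> space \<Omega> | E. E \<in> sets borel})"

text \<open>\<open>Z\<close> is a version of the conditional expectation of the random vector \<open>X\<close> given \<open>F\<close>.\<close>

definition is_cond_exp :: "'a measure \<Rightarrow> 'a measure \<Rightarrow> ('a \<Rightarrow> real^'n) \<Rightarrow> ('a \<Rightarrow> real^'n) \<Rightarrow> bool" where
  "is_cond_exp \<Omega> F X Z \<longleftrightarrow> Z \<in> borel_measurable F \<and>
     (\<forall>i. AE \<omega> in \<Omega>. real_cond_exp \<Omega> F (\<lambda>\<omega>. X \<omega> $ i) \<omega> = Z \<omega> $ i)"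

definition innovation_cov :: "real^'n^'p \<Rightarrow> real^'p^'p \<Rightarrow> real^'n^'n \<Rightarrow> real^'p^'p" where
  "innovation_cov C R P = C ** P ** transpose C + R"

primrec error_cov ::
  "(nat \<Rightarrow> real^'n^'n) \<Rightarrow> (nat \<Rightarrow> real^'n^'p) \<Rightarrow> (nat \<Rightarrow> real^'n^'n) \<Rightarrow> (nat \<Rightarrow> real^'p^'p)
     \<Rightarrow> real^'n^'n \<Rightarrow> nat \<Rightarrow> real^'n^'n" where
  "error_cov A C Q R P0 0 = P0"
| "error_cov A C Q R P0 (Suc k) =
     (let P = error_cov A C Q R P0 k in
        A k ** P ** transpose (A k) + Q k
        - A k ** P ** transpose (C k) ** matrix_inv (innovation_cov (C k) (R k) P)
            ** C k ** P ** transpose (A k))"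

definition kalman_gain ::
  "real^'n^'n \<Rightarrow> real^'n^'p \<Rightarrow> real^'p^'p \<Rightarrow> real^'n^'n \<Rightarrow> real^'p^'n" where
  "kalman_gain A C R P = A ** P ** transpose C ** matrix_inv (innovation_cov C R P)"

text \<open>The supremum is taken in the reals, so the value is meaningful only if \<open>h\<close> has a zero and
  is bounded above near its zero set.\<close>

definition h_margin :: "(real^'n \<Rightarrow> real) \<Rightarrow> real \<Rightarrow> real" where
  "h_margin h \<gamma> = Sup {h x | x. \<exists>x0 \<in> h -` {0}. norm (x - x0) \<le> \<gamma>}"

definition exit_prob :: "'a measure \<Rightarrow> (real^'n \<Rightarrow> real) \<Rightarrow> nat \<Rightarrow> (nat \<Rightarrow> 'a \<Rightarrow> real^'n) \<Rightarrow> real" where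
  "exit_prob \<Omega> g T z = measure \<Omega> {\<omega> \<in> space \<Omega>. (MIN k\<in>{0..T}. g (z k \<omega>)) < 0}"

definition safety_prob :: "'a measure \<Rightarrow> (real^'n \<Rightarrow> real) \<Rightarrow> nat \<Rightarrow> (nat \<Rightarrow> 'a \<Rightarrow> real^'n) \<Rightarrow> real" where
  "safety_prob \<Omega> h T x = 1 - exit_prob \<Omega> h T x"

end

theory Submission
  imports Defs
begin

text \<open>
  The estimation error is a linear function of the independent Gaussian sources, and the
  gain makes it uncorrelated with all earlier innovations. Hence the current innovation is independent
  of the past measurements, with covariance \<open>C P C\<^sup>T + R\<close> given by the Riccati recursion.
  A second-order Taylor bound of \<open>h\<close> at \<open>A xhat + B u\<close>, whose first-order term has zero conditional
  mean, turns the constraint on the input into the drift condition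
  \<open>E[V (k + 1) | F k] \<le> \<alpha> V k + \<beta>\<close> for the nonnegative process
  \<open>V k = (M - h (xhat k)) / (M - h_marg)\<close>, with \<open>\<beta> = 1 - \<alpha> - \<delta> / (M - h_marg)\<close>.
  The exit bounds are Kushner's finite-time estimates for such a process. Finally, if \<open>xhat k\<close> is
  within \<open>\<gamma>\<close> of an unsafe \<open>x k\<close>, then a zero of \<open>h\<close> lies on the segment between them, so
  \<open>h (xhat k) \<le> h_marg\<close>, where equality is excluded almost surely by the nondegeneracy hypothesis.
\<close>

subsection \<open>Uniqueness of Fourier transforms\<close>

text \<open>The input is an arbitrary measurable function of the past measurements, so states,
  estimates and measurements are in general neither Gaussian nor integrable. The input term enters
  \<open>x\<close> and \<open>xhat\<close> alike, however, so it cancels in the error, and errors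
  and innovations remain linear in the sources. Gaussian arguments are applied only to these. The
  past is replaced by the sigma-algebra of the earlier innovations, which contains it because each
  estimate is a function of earlier measurements.

  Independence of uncorrelated Gaussian variables is obtained from characteristic functions. Levy
  uniqueness concerns probability measures on the line, so it is extended to signed and complex
  weights and applied one coordinate at a time. Joint densities never enter, so singular covariances
  are harmless.

  Nothing bounds \<open>h\<close> from below, so \<open>V\<close> may fail to have a mean.
  Expectations in the drift estimate are therefore restricted to the event that no exit has occurred
  so far, where the current \<open>V\<close> is at most one and the constraint bounds
  \<open>h\<close> from below at the predicted state.\<close>

text \<open>By frequency zero the positive and negative parts of the weight have the same mass.
  Normalised, they induce two laws of \<open>R\<close> with the same characteristic function, so
  Levy uniqueness makes the laws equal and the integrals of \<open>f\<close> agree.\<close>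

lemma (in prob_space) fourier_zero_real:
  fixes W R f
  assumes W: "integrable M W" and R [measurable]: "R \<in> borel_measurable M"
    and four: "\<And>t. (CLINT \<omega>|M. complex_of_real (W \<omega>) * iexp (t * R \<omega>)) = 0"
    and f [measurable]: "f \<in> borel_measurable borel"
    and Wf: "integrable M (\<lambda>\<omega>. W \<omega> * f (R \<omega>))"
  shows "(LINT \<omega>|M. W \<omega> * f (R \<omega>)) = (0::real)"
proof -
  have [measurable]: "W \<in> borel_measurable M" using W by auto
  define Wp where "Wp = (\<lambda>\<omega>. max 0 (W \<omega>))"
  define Wn where "Wn = (\<lambda>\<omega>. max 0 (- W \<omega>))"
  have [measurable]: "Wp \<in> borel_measurable M" "Wn \<in> borel_measurable M"
    unfolding Wp_def Wn_def by measurable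
  have nn: "Wp \<omega> \<ge> 0" "Wn \<omega> \<ge> 0" for \<omega> by (auto simp: Wp_def Wn_def)
  have WW: "W \<omega> = Wp \<omega> - Wn \<omega>" for \<omega> by (auto simp: Wp_def Wn_def)
  have bnd: "\<bar>Wp \<omega>\<bar> \<le> \<bar>W \<omega>\<bar>" "\<bar>Wn \<omega>\<bar> \<le> \<bar>W \<omega>\<bar>" for \<omega> by (auto simp: Wp_def Wn_def)
  have int: "integrable M Wp" "integrable M Wn"
    by (auto intro!: Bochner_Integration.integrable_bound[OF W] simp: bnd)
  have intf: "integrable M (\<lambda>\<omega>. Wp \<omega> * f (R \<omega>))" "integrable M (\<lambda>\<omega>. Wn \<omega> * f (R \<omega>))"
    by (auto intro!: Bochner_Integration.integrable_bound[OF Wf] simp: bnd abs_mult mult_right_mono)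
  have inte: "integrable M (\<lambda>\<omega>. complex_of_real (Wp \<omega>) * iexp (t * R \<omega>))"
    "integrable M (\<lambda>\<omega>. complex_of_real (Wn \<omega>) * iexp (t * R \<omega>))" for t
    by (auto intro!: Bochner_Integration.integrable_bound[OF W] simp: bnd norm_mult)
  have eqe: "(CLINT \<omega>|M. complex_of_real (Wp \<omega>) * iexp (t * R \<omega>))
      = (CLINT \<omega>|M. complex_of_real (Wn \<omega>) * iexp (t * R \<omega>))" for t
  proof -
    have "(CLINT \<omega>|M. complex_of_real (Wp \<omega>) * iexp (t * R \<omega>) - complex_of_real (Wn \<omega>) * iexp (t * R \<omega>)) = 0"
      using four[of t] by (simp add: WW left_diff_distrib)
    then show ?thesis using inte by (simp add: Bochner_Integration.integral_diff)
  qed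
  define c where "c = (LINT \<omega>|M. Wp \<omega>)"
  have c': "c = (LINT \<omega>|M. Wn \<omega>)"
    using eqe[of 0] by (simp add: c_def)
  have "c \<ge> 0" by (auto simp: c_def nn)
  have "(LINT \<omega>|M. Wp \<omega> * f (R \<omega>)) = (LINT \<omega>|M. Wn \<omega> * f (R \<omega>))"
  \<comment> \<open>A weight of mass zero cannot be normalised, but it vanishes almost
    everywhere.\<close>
  proof (cases "c = 0")
    case True
    then have "AE \<omega> in M. Wp \<omega> = 0" "AE \<omega> in M. Wn \<omega> = 0"
      using integral_nonneg_eq_0_iff_AE[OF int(1)] integral_nonneg_eq_0_iff_AE[OF int(2)] nn c' c_def
      by auto
    then have "AE \<omega> in M. Wp \<omega> * f (R \<omega>) = Wn \<omega> * f (R \<omega>)" by eventually_elim simp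
    then show ?thesis by (intro integral_cong_AE) auto
  next
    case False
    with \<open>c \<ge> 0\<close> have c: "c > 0" by simp
    have ps: "prob_space (density M (\<lambda>\<omega>. ennreal (V \<omega> / c)))"
      if "integrable M V" "c = (LINT \<omega>|M. V \<omega>)" "\<And>\<omega>. V \<omega> \<ge> 0" for V
    proof (rule prob_spaceI)
      have [measurable]: "V \<in> borel_measurable M" using that by auto
      have "emeasure (density M (\<lambda>\<omega>. ennreal (V \<omega> / c))) (space M) = (\<integral>\<^sup>+\<omega>. ennreal (V \<omega> / c) \<partial>M)"
        by (subst emeasure_density) (auto intro!: nn_integral_cong)
      also have "\<dots> = ennreal (LINT \<omega>|M. V \<omega> / c)"
        using that c by (intro nn_integral_eq_integral) auto
      finally show "emeasure (density M (\<lambda>\<omega>. ennreal (V \<omega> / c))) (space (density M (\<lambda>\<omega>. ennreal (V \<omega> / c)))) = 1"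
        using that c by simp
    qed
    let ?D = "\<lambda>V. distr (density M (\<lambda>\<omega>. ennreal (V \<omega> / c))) borel R"
    interpret p: prob_space "density M (\<lambda>\<omega>. ennreal (Wp \<omega> / c))" by (rule ps) (auto simp: int c_def nn)
    interpret n: prob_space "density M (\<lambda>\<omega>. ennreal (Wn \<omega> / c))" by (rule ps) (auto simp: int c' nn)
    \<comment> \<open>Normalising divides the transform by \<open>c\<close>, the same constant for
      both parts, so \<open>eqe\<close> carries over.\<close>
    have ch: "char (?D V) t = (CLINT \<omega>|M. complex_of_real (V \<omega>) * iexp (t * R \<omega>)) / c"
      if "\<And>\<omega>. V \<omega> \<ge> 0" "V \<in> borel_measurable M" for V t
    proof -
      note that(2)[measurable]
      have "char (?D V) t = (CLINT \<omega>|M. (V \<omega> / c) *\<^sub>R iexp (t * R \<omega>))"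
        unfolding char_def using c that(1)
        by (subst integral_distr, simp, simp, subst integral_density) auto
      also have "\<dots> = (CLINT \<omega>|M. (1/c) *\<^sub>R (complex_of_real (V \<omega>) * iexp (t * R \<omega>)))"
        by (intro Bochner_Integration.integral_cong) (auto simp: scaleR_conv_of_real)
      also have "\<dots> = (1/c) *\<^sub>R (CLINT \<omega>|M. complex_of_real (V \<omega>) * iexp (t * R \<omega>))"
        by (rule integral_scaleR_right)
      finally show ?thesis by (simp add: scaleR_conv_of_real)
    qed
    have "?D Wp = ?D Wn"
    proof (rule Levy_uniqueness)
      show "real_distribution (?D Wp)" by (rule p.real_distribution_distr) simp
      show "real_distribution (?D Wn)" by (rule n.real_distribution_distr) simp
      show "char (?D Wp) = char (?D Wn)"
        by (rule ext) (simp only: ch[OF nn(1)] ch[OF nn(2)] eqe \<open>Wp \<in> borel_measurable M\<close> \<open>Wn \<in> borel_measurable M\<close>)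
    qed
    then have "(LINT r|?D Wp. f r) = (LINT r|?D Wn. f r)" by simp
    moreover have "(LINT r|?D V. f r) = (LINT \<omega>|M. V \<omega> * f (R \<omega>)) / c"
      if "\<And>\<omega>. V \<omega> \<ge> 0" "V \<in> borel_measurable M" for V
    proof -
      note that(2)[measurable]
      have "(LINT r|?D V. f r) = (LINT \<omega>|M. (V \<omega> / c) *\<^sub>R f (R \<omega>))"
        using c that(1) by (subst integral_distr, simp, simp, subst integral_density) auto
      then show ?thesis by simp
    qed
    ultimately show ?thesis using c nn by simp
  qed
  then show ?thesis using intf by (simp add: WW left_diff_distrib)
qed

text \<open>Conjugating the hypothesis at frequency \<open>-t\<close> gives it for the conjugate of
  \<open>W\<close> at \<open>t\<close>. Real and imaginary part are combinations of \<open>W\<close>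
  and its conjugate, so each is a real weight with vanishing transform.\<close>

lemma (in prob_space) fourier_zero_indicator:
  fixes W :: "'a \<Rightarrow> complex"
  assumes W: "integrable M W" and R [measurable]: "R \<in> borel_measurable M"
    and four: "\<And>t. (CLINT \<omega>|M. W \<omega> * iexp (t * R \<omega>)) = 0"
    and B [measurable]: "B \<in> sets borel"
  shows "(CLINT \<omega>|M. W \<omega> * indicator B (R \<omega>)) = 0"
proof -
  have [measurable]: "W \<in> borel_measurable M" using W by auto
  have iW: "integrable M (\<lambda>\<omega>. Re (W \<omega>))" "integrable M (\<lambda>\<omega>. Im (W \<omega>))" using W by auto
  have [measurable]: "cnj \<in> borel_measurable borel"
    by (intro borel_measurable_continuous_onI continuous_intros)
  have inte: "integrable M (\<lambda>\<omega>. W \<omega> * iexp (t * R \<omega>))"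
     "integrable M (\<lambda>\<omega>. cnj (W \<omega>) * iexp (t * R \<omega>))" for t
    by (auto intro!: Bochner_Integration.integrable_bound[OF W] simp: norm_mult)
  have cn: "(CLINT \<omega>|M. cnj (W \<omega>) * iexp (t * R \<omega>)) = 0" for t
  proof -
    have "(CLINT \<omega>|M. cnj (W \<omega>) * iexp (t * R \<omega>)) = (CLINT \<omega>|M. cnj (W \<omega> * iexp (- t * R \<omega>)))"
      by (intro Bochner_Integration.integral_cong) (auto simp: exp_cnj)
    also have "\<dots> = cnj (CLINT \<omega>|M. W \<omega> * iexp (- t * R \<omega>))" by (rule integral_bounded_linear'[OF bounded_linear_cnj bounded_linear_cnj]) simp
    finally show ?thesis using four[of "-t"] by simp
  qed
  have "(CLINT \<omega>|M. complex_of_real (Re (W \<omega>)) * iexp (t * R \<omega>)) = 0" for t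
  proof -
    have "(CLINT \<omega>|M. complex_of_real (Re (W \<omega>)) * iexp (t * R \<omega>))
       = (CLINT \<omega>|M. (1/2) * (W \<omega> * iexp (t * R \<omega>) + cnj (W \<omega>) * iexp (t * R \<omega>)))"
      by (intro Bochner_Integration.integral_cong) (auto simp: complex_eq_iff)
    also have "\<dots> = (1/2) * ((CLINT \<omega>|M. W \<omega> * iexp (t * R \<omega>)) + (CLINT \<omega>|M. cnj (W \<omega>) * iexp (t * R \<omega>)))"
      using inte by (subst integral_mult_right_zero, subst Bochner_Integration.integral_add) auto
    finally show ?thesis using four cn by simp
  qed
  note re = fourier_zero_real[OF iW(1) R this, of "indicator B"]
  have "(CLINT \<omega>|M. complex_of_real (Im (W \<omega>)) * iexp (t * R \<omega>)) = 0" for t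
  proof -
    have "(CLINT \<omega>|M. complex_of_real (Im (W \<omega>)) * iexp (t * R \<omega>))
       = (CLINT \<omega>|M. (- \<i>/2) * (W \<omega> * iexp (t * R \<omega>) - cnj (W \<omega>) * iexp (t * R \<omega>)))"
    proof (intro Bochner_Integration.integral_cong refl)
      fix \<omega>
      have "complex_of_real (Im (W \<omega>)) = (- \<i>/2) * (W \<omega> - cnj (W \<omega>))"
        by (simp add: complex_eq_iff)
      then show "complex_of_real (Im (W \<omega>)) * iexp (t * R \<omega>)
          = (- \<i>/2) * (W \<omega> * iexp (t * R \<omega>) - cnj (W \<omega>) * iexp (t * R \<omega>))"
        by (simp only: left_diff_distrib mult.assoc)
    qed
    also have "\<dots> = (- \<i>/2) * ((CLINT \<omega>|M. W \<omega> * iexp (t * R \<omega>)) - (CLINT \<omega>|M. cnj (W \<omega>) * iexp (t * R \<omega>)))"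
      using inte by (subst integral_mult_right_zero, subst Bochner_Integration.integral_diff) auto
    finally show ?thesis using four cn by simp
  qed
  note im = fourier_zero_real[OF iW(2) R this, of "indicator B"]
  have b: "integrable M (\<lambda>\<omega>. V \<omega> * indicator B (R \<omega>))" if "integrable M V" for V :: "'a \<Rightarrow> real"
    using borel_measurable_integrable[OF that]
    by (auto intro!: Bochner_Integration.integrable_bound[OF that] simp: abs_mult indicator_def)
  note b = b[OF iW(1)] b[OF iW(2)]
  have "(CLINT \<omega>|M. W \<omega> * indicator B (R \<omega>))
     = (CLINT \<omega>|M. complex_of_real (Re (W \<omega>) * indicator B (R \<omega>)) + \<i> * complex_of_real (Im (W \<omega>) * indicator B (R \<omega>)))"
    by (intro Bochner_Integration.integral_cong) (auto simp: complex_eq_iff indicator_def)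
  also have "\<dots> = 0"
    using b re im by (subst Bochner_Integration.integral_add)
     (auto simp del: of_real_mult simp: integral_mult_right_zero)
  finally show ?thesis .
qed

text \<open>One coordinate is treated at a time. The exponentials of the remaining coordinates are
  absorbed into the weight, which is why weights are complex; the indicator gained then joins the
  weight of the induction hypothesis.\<close>

lemma (in prob_space) fourier_zero_rectangle:
  fixes W :: "'a \<Rightarrow> complex" and R :: "'i \<Rightarrow> 'a \<Rightarrow> real"
  assumes "finite J" "integrable M W" "\<And>j. j \<in> J \<Longrightarrow> R j \<in> borel_measurable M"
    and "\<And>t. (CLINT \<omega>|M. W \<omega> * iexp (\<Sum>j\<in>J. t j * R j \<omega>)) = 0"
    and "\<And>j. j \<in> J \<Longrightarrow> B j \<in> sets borel"
  shows "(CLINT \<omega>|M. W \<omega> * (\<Prod>j\<in>J. indicator (B j) (R j \<omega>))) = 0"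
  using assms
proof (induction J arbitrary: W rule: finite_induct)
  case empty
  then show ?case by simp
next
  case (insert j J)
  note [measurable] = insert.prems(2,4)
  have [measurable]: "W \<in> borel_measurable M" using insert.prems by auto
  note W = insert.prems(1)
  have "(CLINT \<omega>|M. (W \<omega> * indicator (B j) (R j \<omega>)) * (\<Prod>j\<in>J. indicator (B j) (R j \<omega>))) = 0"
  proof (rule insert.IH)
    show "integrable M (\<lambda>\<omega>. W \<omega> * indicator (B j) (R j \<omega>))"
      by (auto intro!: Bochner_Integration.integrable_bound[OF W] simp: norm_mult indicator_def)
    fix t :: "'i \<Rightarrow> real"
    let ?V = "\<lambda>\<omega>. W \<omega> * iexp (\<Sum>j\<in>J. t j * R j \<omega>)"
    have "(CLINT \<omega>|M. ?V \<omega> * indicator (B j) (R j \<omega>)) = 0"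
    proof (rule fourier_zero_indicator)
      show "integrable M ?V"
        by (auto intro!: Bochner_Integration.integrable_bound[OF W] borel_measurable_sum simp: norm_mult insert.prems)
      fix s
      \<comment> \<open>Updating \<open>t\<close> at \<open>j\<close> isolates the frequency
        \<open>s\<close> of the new coordinate in the joint hypothesis.\<close>
      have "(\<Sum>i\<in>insert j J. (t(j := s)) i * R i \<omega>) = s * R j \<omega> + (\<Sum>i\<in>J. t i * R i \<omega>)" for \<omega>
        using insert.hyps by (auto intro!: sum.cong)
      then show "(CLINT \<omega>|M. ?V \<omega> * iexp (s * R j \<omega>)) = 0"
        using insert.prems(3)[of "t(j := s)"]
        by (simp add: distrib_left exp_add mult_ac)
    qed auto
    then show "(CLINT \<omega>|M. (W \<omega> * indicator (B j) (R j \<omega>)) * iexp (\<Sum>j\<in>J. t j * R j \<omega>)) = 0"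
      by (simp add: mult_ac)
  qed (auto simp: insert.prems)
  then show ?case using insert.hyps by (simp add: mult_ac)
qed

text \<open>Dynkin argument: the sets over which the weight integrates to zero are closed under
  disjoint countable unions and, since frequency zero makes the total integral vanish, under
  complements.\<close>

lemma (in prob_space) fourier_zero_sigma:
  fixes W :: "'a \<Rightarrow> complex" and R :: "'i \<Rightarrow> 'a \<Rightarrow> real"
  assumes J: "finite J" and W: "integrable M W" and R: "\<And>j. j \<in> J \<Longrightarrow> R j \<in> borel_measurable M"
    and four: "\<And>t. (CLINT \<omega>|M. W \<omega> * iexp (\<Sum>j\<in>J. t j * R j \<omega>)) = 0"
    and A: "A \<in> sigma_sets (space M) (\<Union>j\<in>J. {R j -` B \<inter> space M | B. B \<in> sets borel})"
  shows "(CLINT \<omega>|M. W \<omega> * indicator A \<omega>) = 0"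
proof -
  have [measurable]: "W \<in> borel_measurable M" using W by auto
  \<comment> \<open>The generating preimages are not stable under intersection. Rectangles are, and
    sides equal to \<open>UNIV\<close> recover the generators.\<close>
  define G where "G = {{\<omega> \<in> space M. \<forall>j\<in>J. R j \<omega> \<in> B j} | B. \<forall>j\<in>J. B j \<in> sets (borel::real measure)}"
  have gen: "(\<Union>j\<in>J. {R j -` B \<inter> space M | B. B \<in> sets borel}) \<subseteq> G"
  proof safe
    fix j B assume j: "j \<in> J" and B: "B \<in> sets (borel :: real measure)"
    have "R j -` B \<inter> space M = {\<omega> \<in> space M. \<forall>i\<in>J. R i \<omega> \<in> (if i = j then B else UNIV)}"
      using j by auto
    then show "R j -` B \<inter> space M \<in> G" unfolding G_def using B
      by (auto intro!: exI[of _ "\<lambda>i. if i = j then B else UNIV"])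
  qed
  have GM: "G \<subseteq> sets M"
  proof
    fix A assume "A \<in> G"
    then obtain B where B: "\<And>j. j \<in> J \<Longrightarrow> B j \<in> sets borel" "A = {\<omega> \<in> space M. \<forall>j\<in>J. R j \<omega> \<in> B j}"
      unfolding G_def by auto
    note [measurable] = B(1) R
    show "A \<in> sets M" unfolding B(2) using J by measurable
  qed
  have "Int_stable G"
  proof (rule Int_stableI)
    fix a b assume "a \<in> G" "b \<in> G"
    then obtain B B' where "\<And>j. j \<in> J \<Longrightarrow> B j \<in> sets borel" "a = {\<omega> \<in> space M. \<forall>j\<in>J. R j \<omega> \<in> B j}"
      "\<And>j. j \<in> J \<Longrightarrow> B' j \<in> sets borel" "b = {\<omega> \<in> space M. \<forall>j\<in>J. R j \<omega> \<in> B' j}"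
      unfolding G_def by auto
    then show "a \<inter> b \<in> G" unfolding G_def
      by (auto intro!: exI[of _ "\<lambda>j. B j \<inter> B' j"])
  qed
  moreover have "G \<subseteq> Pow (space M)" by (auto simp: G_def)
  moreover have "A \<in> sigma_sets (space M) G" using A sigma_sets_subseteq[OF gen] by auto
  ultimately show ?thesis
  proof (induction rule: sigma_sets_induct_disjoint)
    case (basic A)
    then obtain B where B: "\<And>j. j \<in> J \<Longrightarrow> B j \<in> sets borel" "A = {\<omega> \<in> space M. \<forall>j\<in>J. R j \<omega> \<in> B j}"
      unfolding G_def by auto
    have "(CLINT \<omega>|M. W \<omega> * indicator A \<omega>) = (CLINT \<omega>|M. W \<omega> * (\<Prod>j\<in>J. indicator (B j) (R j \<omega>)))"
    proof (intro Bochner_Integration.integral_cong refl)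
      fix \<omega> assume "\<omega> \<in> space M"
      then have "(\<Prod>j\<in>J. indicator (B j) (R j \<omega>)) = (indicator A \<omega> :: complex)"
        using J unfolding B(2) by (auto simp: indicator_def prod_zero_iff intro!: prod.neutral)
      then show "W \<omega> * indicator A \<omega> = W \<omega> * (\<Prod>j\<in>J. indicator (B j) (R j \<omega>))" by simp
    qed
    then show ?case using fourier_zero_rectangle[OF J W R four, of B] B(1) by simp
  next
    case empty
    show ?case by simp
  next
    case (compl A)
    have [measurable]: "A \<in> sets M" using compl(1) GM sets.sigma_sets_subset by blast
    have "(CLINT \<omega>|M. W \<omega> * indicator (space M - A) \<omega>) = (CLINT \<omega>|M. W \<omega> - W \<omega> * indicator A \<omega>)"
      by (intro Bochner_Integration.integral_cong) (auto simp: indicator_def)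
    also have "\<dots> = (CLINT \<omega>|M. W \<omega>) - (CLINT \<omega>|M. W \<omega> * indicator A \<omega>)"
      using W by (intro Bochner_Integration.integral_diff)
        (auto intro!: Bochner_Integration.integrable_bound[OF W] simp: norm_mult indicator_def)
    finally show ?case using compl(2) four[of "\<lambda>_. 0"] by simp
  next
    case (union A)
    have [measurable]: "A i \<in> sets M" for i using union(2) GM sets.sigma_sets_subset by blast
    have ind: "W \<omega> * indicator B \<omega> = indicator B \<omega> *\<^sub>R W \<omega>" for B \<omega>
      by (simp add: indicator_def)
    have "(LINT \<omega>:(\<Union>i. A i)|M. W \<omega>) = (\<Sum>i. (LINT \<omega>:(A i)|M. W \<omega>))"
    proof (rule lebesgue_integral_countable_add)
      show "set_integrable M (\<Union>i. A i) W" unfolding set_integrable_def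
        by (auto intro!: Bochner_Integration.integrable_bound[OF W] simp: indicator_def)
    qed (use union(1) in \<open>auto simp: disjoint_family_on_def\<close>)
    then show ?case using union(3) by (simp add: ind set_lebesgue_integral_def)
  qed
qed

subsection \<open>Independence of uncorrelated Gaussian variables\<close>

lemma integrable_mult_of_squares:
  fixes X Y :: "'a \<Rightarrow> real"
  assumes [measurable]: "X \<in> borel_measurable M" "Y \<in> borel_measurable M"
    and "integrable M (\<lambda>\<omega>. (X \<omega>)\<^sup>2)" "integrable M (\<lambda>\<omega>. (Y \<omega>)\<^sup>2)"
  shows "integrable M (\<lambda>\<omega>. X \<omega> * Y \<omega>)"
proof (rule Bochner_Integration.integrable_bound)
  show "integrable M (\<lambda>\<omega>. (X \<omega>)\<^sup>2 + (Y \<omega>)\<^sup>2)" using assms by simp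
  have "\<bar>a * b\<bar> \<le> a\<^sup>2 + b\<^sup>2" for a b :: real
    using sum_squares_bound[of "\<bar>a\<bar>" "\<bar>b\<bar>"] abs_ge_zero[of "a * b"] unfolding abs_mult power2_abs by linarith
  then show "AE \<omega> in M. norm (X \<omega> * Y \<omega>) \<le> norm ((X \<omega>)\<^sup>2 + (Y \<omega>)\<^sup>2)" by simp
qed simp

text \<open>The characteristic function is prescribed at frequency one only. The predicate is used
  for whole linear spaces of variables, where scaling the variable yields every frequency. The zero
  variable satisfies it, which admits singular covariances.\<close>

definition centered_gaussian :: "'a measure \<Rightarrow> ('a \<Rightarrow> real) \<Rightarrow> bool" where
  "centered_gaussian M X \<longleftrightarrow> X \<in> borel_measurable M \<and> integrable M (\<lambda>\<omega>. (X \<omega>)\<^sup>2) \<and>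
     (LINT \<omega>|M. X \<omega>) = 0 \<and>
     (CLINT \<omega>|M. iexp (X \<omega>)) = complex_of_real (exp (- (LINT \<omega>|M. (X \<omega>)\<^sup>2) / 2))"

lemma centered_gaussianD:
  assumes "centered_gaussian M X"
  shows "X \<in> borel_measurable M" "integrable M (\<lambda>\<omega>. (X \<omega>)\<^sup>2)" "(LINT \<omega>|M. X \<omega>) = 0"
    "(CLINT \<omega>|M. iexp (X \<omega>)) = complex_of_real (exp (- (LINT \<omega>|M. (X \<omega>)\<^sup>2) / 2))"
  using assms by (auto simp: centered_gaussian_def)

lemma (in prob_space) centered_gaussian_integrable:
  "centered_gaussian M X \<Longrightarrow> integrable M X"
  using square_integrable_imp_integrable by (blast dest: centered_gaussianD)

text \<open>Vanishing correlation makes the variance of \<open>s * Z\<close> plus a combination of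
  the \<open>R j\<close> additive, so the characteristic function factors. Fourier uniqueness is
  then used twice: over the \<open>R j\<close> to reach the event \<open>A\<close>, and over
  \<open>Z\<close> to reach \<open>f\<close>.\<close>

lemma (in prob_space) uncorrelated_gaussian_independence:
  fixes Z :: "'a \<Rightarrow> real" and R :: "'i \<Rightarrow> 'a \<Rightarrow> real"
  assumes J: "finite J"
    and cg: "\<And>s t. centered_gaussian M (\<lambda>\<omega>. s * Z \<omega> + (\<Sum>j\<in>J. t j * R j \<omega>))"
    and orth: "\<And>j. j \<in> J \<Longrightarrow> (LINT \<omega>|M. Z \<omega> * R j \<omega>) = 0"
    and A: "A \<in> sigma_sets (space M) (\<Union>j\<in>J. {R j -` B \<inter> space M | B. B \<in> sets borel})"
    and f [measurable]: "f \<in> borel_measurable borel"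
    and fZ: "integrable M (\<lambda>\<omega>. f (Z \<omega>))"
  shows "(LINT \<omega>|M. indicator A \<omega> * f (Z \<omega>)) = prob A * (LINT \<omega>|M. f (Z \<omega>) :: real)"
proof -
  have cgZ: "centered_gaussian M (\<lambda>\<omega>. s * Z \<omega>)" for s using cg[of s "\<lambda>_. 0"] by simp
  have [measurable]: "Z \<in> borel_measurable M" and Z2: "integrable M (\<lambda>\<omega>. (Z \<omega>)\<^sup>2)"
    using cgZ[of 1] by (auto dest: centered_gaussianD)
  have cgR: "centered_gaussian M (R j)" if "j \<in> J" for j
  proof -
    have "(\<lambda>\<omega>. 0 * Z \<omega> + (\<Sum>i\<in>J. (if i = j then 1 else 0) * R i \<omega>)) = R j"
      using that J by (auto simp: sum.delta if_distrib[of "\<lambda>x. x * _"] cong: if_cong)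
    then show ?thesis using cg[of 0 "\<lambda>i. if i = j then 1 else 0"] by simp
  qed
  have Rm: "\<And>j. j \<in> J \<Longrightarrow> R j \<in> borel_measurable M" and R2: "\<And>j. j \<in> J \<Longrightarrow> integrable M (\<lambda>\<omega>. (R j \<omega>)\<^sup>2)"
    using cgR by (auto dest: centered_gaussianD)
  have AM [measurable]: "A \<in> sets M"
    using A Rm by (rule_tac sets.sigma_sets_subset[THEN subsetD, OF _ A]) auto
  define c where "c s = complex_of_real (exp (- (s\<^sup>2 * (LINT \<omega>|M. (Z \<omega>)\<^sup>2)) / 2))" for s
  have cZ: "(CLINT \<omega>|M. iexp (s * Z \<omega>)) = c s" for s
    using centered_gaussianD(4)[OF cgZ[of s]] by (simp add: c_def power_mult_distrib)
  \<comment> \<open>The weight is the centred exponential of \<open>Z\<close>; its transform in the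
    \<open>R j\<close> vanishes because the joint characteristic function factors.\<close>
  have "(CLINT \<omega>|M. (iexp (s * Z \<omega>) - c s) * indicator A \<omega>) = 0" for s
  proof (rule fourier_zero_sigma[OF J _ Rm _ A])
    show "integrable M (\<lambda>\<omega>. iexp (s * Z \<omega>) - c s)"
      by (intro Bochner_Integration.integrable_diff integrable_const integrable_const_bound[where B = 1]) auto
    fix t :: "'i \<Rightarrow> real"
    let ?Y = "\<lambda>\<omega>. \<Sum>j\<in>J. t j * R j \<omega>"
    have Y: "centered_gaussian M ?Y" using cg[of 0 t] by simp
    note [measurable] = centered_gaussianD(1)[OF Y]
    have ZR: "integrable M (\<lambda>\<omega>. Z \<omega> * R j \<omega>)" if "j \<in> J" for j
      using that by (intro integrable_mult_of_squares Z2 R2 Rm) auto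
    have ZY: "integrable M (\<lambda>\<omega>. Z \<omega> * ?Y \<omega>)"
      by (intro integrable_mult_of_squares Z2 centered_gaussianD(1,2)[OF Y]) auto
    have "(LINT \<omega>|M. Z \<omega> * ?Y \<omega>) = (LINT \<omega>|M. (\<Sum>j\<in>J. t j * (Z \<omega> * R j \<omega>)))"
      by (simp add: sum_distrib_left mult_ac)
    also have "\<dots> = (\<Sum>j\<in>J. t j * (LINT \<omega>|M. Z \<omega> * R j \<omega>))"
      using ZR by (subst Bochner_Integration.integral_sum) auto
    finally have ZY0: "(LINT \<omega>|M. Z \<omega> * ?Y \<omega>) = 0" using orth by simp
    have "(LINT \<omega>|M. (s * Z \<omega> + ?Y \<omega>)\<^sup>2)
        = (LINT \<omega>|M. s\<^sup>2 * (Z \<omega>)\<^sup>2 + (?Y \<omega>)\<^sup>2 + (2 * s) * (Z \<omega> * ?Y \<omega>))"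
      by (intro Bochner_Integration.integral_cong) (auto simp: power2_sum power_mult_distrib)
    also have "\<dots> = (LINT \<omega>|M. s\<^sup>2 * (Z \<omega>)\<^sup>2 + (?Y \<omega>)\<^sup>2) + (LINT \<omega>|M. (2 * s) * (Z \<omega> * ?Y \<omega>))"
      using Z2 ZY centered_gaussianD(2)[OF Y] by (intro Bochner_Integration.integral_add) auto
    also have "\<dots> = s\<^sup>2 * (LINT \<omega>|M. (Z \<omega>)\<^sup>2) + (LINT \<omega>|M. (?Y \<omega>)\<^sup>2)"
      using Z2 ZY0 centered_gaussianD(2)[OF Y] by (subst Bochner_Integration.integral_add) auto
    finally have var: "(LINT \<omega>|M. (s * Z \<omega> + ?Y \<omega>)\<^sup>2) = s\<^sup>2 * (LINT \<omega>|M. (Z \<omega>)\<^sup>2) + (LINT \<omega>|M. (?Y \<omega>)\<^sup>2)" .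
    have "(CLINT \<omega>|M. iexp (s * Z \<omega>) * iexp (?Y \<omega>)) = (CLINT \<omega>|M. iexp (s * Z \<omega> + ?Y \<omega>))"
      by (simp add: exp_add distrib_left)
    also have "\<dots> = c s * (CLINT \<omega>|M. iexp (?Y \<omega>))"
      unfolding centered_gaussianD(4)[OF cg[of s t]] centered_gaussianD(4)[OF Y] var c_def
        of_real_mult[symmetric] exp_add[symmetric] by (simp add: add_divide_distrib)
    finally have *: "(CLINT \<omega>|M. iexp (s * Z \<omega>) * iexp (?Y \<omega>)) = c s * (CLINT \<omega>|M. iexp (?Y \<omega>))" .
    have "(CLINT \<omega>|M. (iexp (s * Z \<omega>) - c s) * iexp (?Y \<omega>))
       = (CLINT \<omega>|M. iexp (s * Z \<omega>) * iexp (?Y \<omega>) - c s * iexp (?Y \<omega>))"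
      by (simp add: left_diff_distrib)
    also have "\<dots> = (CLINT \<omega>|M. iexp (s * Z \<omega>) * iexp (?Y \<omega>)) - (CLINT \<omega>|M. c s * iexp (?Y \<omega>))"
      by (intro Bochner_Integration.integral_diff integrable_mult_right integrable_const_bound[where B = 1])
        (auto simp: norm_mult simp del: of_real_sum)
    also have "\<dots> = 0" unfolding * by (subst integral_mult_right_zero) simp
    finally show "(CLINT \<omega>|M. (iexp (s * Z \<omega>) - c s) * iexp (?Y \<omega>)) = 0" .
  qed
  then have 1: "(CLINT \<omega>|M. iexp (s * Z \<omega>) * indicator A \<omega>) = c s * prob A" for s
  proof -
    assume "\<And>s. (CLINT \<omega>|M. (iexp (s * Z \<omega>) - c s) * indicator A \<omega>) = 0"
    then have "0 = (CLINT \<omega>|M. iexp (s * Z \<omega>) * indicator A \<omega> - c s * indicator A \<omega>)"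
      by (simp add: left_diff_distrib)
    also have "\<dots> = (CLINT \<omega>|M. iexp (s * Z \<omega>) * indicator A \<omega>) - (CLINT \<omega>|M. c s * indicator A \<omega>)"
      by (intro Bochner_Integration.integral_diff integrable_mult_right integrable_const_bound[where B = 1])
        (auto simp: norm_mult indicator_def)
    also have "(CLINT \<omega>|M. c s * indicator A \<omega>) = c s * (CLINT \<omega>|M. complex_of_real (indicator A \<omega>))"
      by (subst integral_mult_right_zero[symmetric], intro Bochner_Integration.integral_cong)
        (auto simp: indicator_def)
    also have "(CLINT \<omega>|M. complex_of_real (indicator A \<omega>)) = prob A"
      by (subst integral_complex_of_real) simp
    finally show ?thesis by simp
  qed
  have iA: "integrable M (\<lambda>\<omega>. indicator A \<omega> * f (Z \<omega>))"
    by (auto intro!: Bochner_Integration.integrable_bound[OF fZ] simp: indicator_def)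
  \<comment> \<open>The roles change: the centred indicator of \<open>A\<close> is now the weight
    and \<open>Z\<close> carries the frequency.\<close>
  have "(LINT \<omega>|M. (indicator A \<omega> - prob A) * f (Z \<omega>)) = 0"
  proof (rule fourier_zero_real[where R = Z and f = f])
    show "integrable M (\<lambda>\<omega>. indicator A \<omega> - prob A)"
      by (intro Bochner_Integration.integrable_diff integrable_const integrable_const_bound[where B = 1]) auto
    show "integrable M (\<lambda>\<omega>. (indicator A \<omega> - prob A) * f (Z \<omega>))"
      using iA fZ by (simp add: left_diff_distrib)
    fix s
    have "(CLINT \<omega>|M. complex_of_real (indicator A \<omega> - prob A) * iexp (s * Z \<omega>))
       = (CLINT \<omega>|M. iexp (s * Z \<omega>) * indicator A \<omega> - prob A * iexp (s * Z \<omega>))"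
      by (intro Bochner_Integration.integral_cong) (auto simp: indicator_def algebra_simps)
    also have "\<dots> = (CLINT \<omega>|M. iexp (s * Z \<omega>) * indicator A \<omega>) - (CLINT \<omega>|M. prob A * iexp (s * Z \<omega>))"
      by (intro Bochner_Integration.integral_diff)
        (auto intro!: integrable_const_bound[where B = 1] simp: norm_mult indicator_def)
    also have "\<dots> = 0" unfolding 1 by (subst integral_mult_right_zero) (simp only: cZ, simp)
    finally show "(CLINT \<omega>|M. complex_of_real (indicator A \<omega> - prob A) * iexp (s * Z \<omega>)) = 0" .
  qed auto
  then show ?thesis using iA fZ by (simp add: left_diff_distrib)
qed

lemma (in prob_space) indep_vars_expectation_mult:
  fixes X :: "'i \<Rightarrow> 'a \<Rightarrow> real"
  assumes "indep_vars (\<lambda>_. borel) X J" "i \<in> J" "j \<in> J" "i \<noteq> j"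
    and "integrable M (X i)" "integrable M (X j)"
  shows "(LINT \<omega>|M. X i \<omega> * X j \<omega>) = (LINT \<omega>|M. X i \<omega>) * (LINT \<omega>|M. X j \<omega>)"
  using indep_vars_lebesgue_integral[of "{i, j}" X] indep_vars_subset[OF assms(1), of "{i, j}"] assms
  by auto

text \<open>Independence factors the characteristic function, and zero means remove the cross terms
  of the square, so the exponents add up to minus half the variance of the sum.\<close>

lemma (in prob_space) centered_gaussian_indep_sum:
  fixes X :: "'i \<Rightarrow> 'a \<Rightarrow> real"
  assumes J: "finite J" and ind: "indep_vars (\<lambda>_. borel) X J"
    and cg: "\<And>j. j \<in> J \<Longrightarrow> centered_gaussian M (X j)"
  shows "centered_gaussian M (\<lambda>\<omega>. \<Sum>j\<in>J. X j \<omega>)"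
    and "(LINT \<omega>|M. (\<Sum>j\<in>J. X j \<omega>)\<^sup>2) = (\<Sum>j\<in>J. LINT \<omega>|M. (X j \<omega>)\<^sup>2)"
proof -
  note D = centered_gaussianD[OF cg]
  have Xm: "random_variable borel (X j)" if "j \<in> J" for j using D that by auto
  have int: "integrable M (X j)" if "j \<in> J" for j using that cg centered_gaussian_integrable by auto
  have int2: "integrable M (\<lambda>\<omega>. X i \<omega> * X j \<omega>)" if "i \<in> J" "j \<in> J" for i j
    using that by (intro integrable_mult_of_squares D)
  have sq: "(\<Sum>j\<in>J. X j \<omega>)\<^sup>2 = (\<Sum>i\<in>J. \<Sum>j\<in>J. X i \<omega> * X j \<omega>)" for \<omega>
    by (simp add: power2_eq_square sum_product)
  have "(LINT \<omega>|M. (\<Sum>j\<in>J. X j \<omega>)\<^sup>2) = (\<Sum>i\<in>J. \<Sum>j\<in>J. LINT \<omega>|M. X i \<omega> * X j \<omega>)"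
    unfolding sq using int2 by (subst Bochner_Integration.integral_sum, force)
      (intro sum.cong refl Bochner_Integration.integral_sum, auto)
  also have "\<dots> = (\<Sum>i\<in>J. \<Sum>j\<in>J. if i = j then LINT \<omega>|M. (X i \<omega>)\<^sup>2 else 0)"
    using indep_vars_expectation_mult[OF ind] int D(3)
    by (intro sum.cong refl) (auto simp: power2_eq_square)
  also have "\<dots> = (\<Sum>j\<in>J. LINT \<omega>|M. (X j \<omega>)\<^sup>2)"
    using J by (simp add: sum.delta)
  finally show var: "(LINT \<omega>|M. (\<Sum>j\<in>J. X j \<omega>)\<^sup>2) = (\<Sum>j\<in>J. LINT \<omega>|M. (X j \<omega>)\<^sup>2)" .
  have "(CLINT \<omega>|M. iexp (\<Sum>j\<in>J. X j \<omega>)) = (CLINT \<omega>|M. (\<Prod>j\<in>J. iexp (X j \<omega>)))"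
    using J by (simp add: sum_distrib_left exp_sum)
  also have "\<dots> = (\<Prod>j\<in>J. CLINT \<omega>|M. iexp (X j \<omega>))"
  proof (rule indep_vars_lebesgue_integral[OF J])
    show "indep_vars (\<lambda>_. borel) (\<lambda>j \<omega>. iexp (X j \<omega>)) J"
      by (rule indep_vars_compose2[OF ind]) simp
    show "integrable M (\<lambda>\<omega>. iexp (X j \<omega>))" if "j \<in> J" for j
      using Xm[OF that] by (auto intro!: integrable_const_bound[where B = 1])
  qed
  also have "\<dots> = (\<Prod>j\<in>J. complex_of_real (exp (- (LINT \<omega>|M. (X j \<omega>)\<^sup>2) / 2)))"
    by (intro prod.cong refl D(4))
  also have "\<dots> = complex_of_real (exp (\<Sum>j\<in>J. - (LINT \<omega>|M. (X j \<omega>)\<^sup>2) / 2))"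
    using J by (simp add: exp_sum)
  also have "(\<Sum>j\<in>J. - (LINT \<omega>|M. (X j \<omega>)\<^sup>2) / 2) = - (LINT \<omega>|M. (\<Sum>j\<in>J. X j \<omega>)\<^sup>2) / 2"
    unfolding var by (simp add: sum_divide_distrib sum_negf)
  finally have ch: "(CLINT \<omega>|M. iexp (\<Sum>j\<in>J. X j \<omega>)) = complex_of_real (exp (- (LINT \<omega>|M. (\<Sum>j\<in>J. X j \<omega>)\<^sup>2) / 2))" .
  have "(LINT \<omega>|M. (\<Sum>j\<in>J. X j \<omega>)) = 0" using int D(3) by simp
  moreover have "integrable M (\<lambda>\<omega>. (\<Sum>j\<in>J. X j \<omega>)\<^sup>2)"
    unfolding sq using int2 by auto
  moreover have "(\<lambda>\<omega>. \<Sum>j\<in>J. X j \<omega>) \<in> borel_measurable M"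
    using Xm by auto
  ultimately show "centered_gaussian M (\<lambda>\<omega>. \<Sum>j\<in>J. X j \<omega>)"
    unfolding centered_gaussian_def using ch by auto
qed

lemma (in prob_space) centered_gaussian_AE_0:
  assumes [measurable]: "X \<in> borel_measurable M" and "AE \<omega> in M. X \<omega> = 0"
  shows "centered_gaussian M X"
proof -
  have "(LINT \<omega>|M. X \<omega>) = (LINT \<omega>|M. 0)" "(LINT \<omega>|M. (X \<omega>)\<^sup>2) = (LINT \<omega>|M. 0)"
    "(CLINT \<omega>|M. iexp (X \<omega>)) = (CLINT \<omega>|M. 1)"
    by (rule integral_cong_AE, simp, simp, use assms(2) in eventually_elim, simp)+
  moreover have "integrable M (\<lambda>\<omega>. (X \<omega>)\<^sup>2)"
    using assms(2) by (subst integrable_cong_AE[of _ _ "\<lambda>_. 0"]) auto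
  ultimately show ?thesis using prob_space by (simp add: centered_gaussian_def)
qed

lemma (in prob_space) centered_gaussian_normal:
  assumes s: "s > 0" and D: "distributed M lborel X (\<lambda>x. ennreal (normal_density m s x))"
  shows "centered_gaussian M (\<lambda>\<omega>. X \<omega> - m)"
proof -
  have [measurable]: "X \<in> borel_measurable M" using distributed_measurable[OF D] by simp
  define Y where "Y \<omega> = (X \<omega> - m) / s" for \<omega>
  have DY: "distributed M lborel Y (\<lambda>x. ennreal (std_normal_density x))"
    using D unfolding normal_standard_normal_convert[OF s] Y_def .
  have [measurable]: "Y \<in> borel_measurable M" unfolding Y_def by simp
  have YX: "X \<omega> - m = s * Y \<omega>" for \<omega> using s by (simp add: Y_def)
  have i2: "integrable M (\<lambda>\<omega>. (Y \<omega>)\<^sup>2)"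
    using integrable_std_normal_moment[of 2] distributed_integrable[OF DY, of "\<lambda>x. x\<^sup>2"] by simp
  have v: "(LINT \<omega>|M. (Y \<omega>)\<^sup>2) = 1"
    using standard_normal_distributed_variance[OF DY] standard_normal_distributed_expectation[OF DY] by simp
  have "distr M borel Y = distr M lborel Y" by (rule distr_cong) auto
  then have "distr M borel Y = std_normal_distribution"
    using distributed_distr_eq_density[OF DY] by simp
  then have "char (distr M borel Y) s = complex_of_real (exp (- (s\<^sup>2) / 2))"
    by (simp add: char_std_normal_distribution)
  then have "(CLINT \<omega>|M. iexp (s * Y \<omega>)) = complex_of_real (exp (- (s\<^sup>2) / 2))"
    unfolding char_def by (subst (asm) integral_distr) auto
  moreover have "(LINT \<omega>|M. (s * Y \<omega>)\<^sup>2) = s\<^sup>2" using v by (simp add: power_mult_distrib)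
  ultimately show ?thesis
    unfolding centered_gaussian_def YX using i2 standard_normal_distributed_expectation[OF DY]
    by (simp add: power_mult_distrib)
qed

lemma integrable_of_inner:
  fixes X :: "'a \<Rightarrow> 'b::euclidean_space"
  assumes "\<And>a. integrable M (\<lambda>\<omega>. X \<omega> \<bullet> a)"
  shows "integrable M X"
proof -
  have "integrable M (\<lambda>\<omega>. \<Sum>b\<in>Basis. (X \<omega> \<bullet> b) *\<^sub>R b)" using assms by auto
  then show ?thesis by (simp add: euclidean_representation)
qed

text \<open>The definition supplies a centre for each direction separately. Integrability of all
  projections yields a mean vector, and the zero mean of each centred projection identifies its
  centre with the projection of that vector.\<close>

lemma (in prob_space) gaussian_vector_centered:
  assumes "gaussian_vector M X"
  shows "integrable M X" "\<And>a. centered_gaussian M (\<lambda>\<omega>. a \<bullet> (X \<omega> - (LINT \<omega>|M. X \<omega>)))"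
proof -
  have [measurable]: "X \<in> borel_measurable M" using assms by (simp add: gaussian_vector_def)
  have ex: "\<exists>m. centered_gaussian M (\<lambda>\<omega>. a \<bullet> X \<omega> - m)" for a
  proof -
    obtain m s where s: "s \<ge> 0" and d: "distr M borel (\<lambda>\<omega>. a \<bullet> X \<omega>) =
          (if s = 0 then return borel m else density lborel (\<lambda>t. ennreal (normal_density m s t)))"
      using assms unfolding gaussian_vector_def by metis
    show ?thesis
    proof (cases "s = 0")
      case True
      have "AE t in return borel m. t = m" by (subst AE_return) auto
      then have "AE \<omega> in M. a \<bullet> X \<omega> = m"
        unfolding d[unfolded True, simplified, symmetric] by (subst (asm) AE_distr_iff) auto
      then show ?thesis by (intro exI[of _ m] centered_gaussian_AE_0) auto
    next
      case False
      have "distributed M lborel (\<lambda>\<omega>. a \<bullet> X \<omega>) (\<lambda>x. ennreal (normal_density m s x))"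
        unfolding distributed_def using d False distr_cong[of M M borel lborel "\<lambda>\<omega>. a \<bullet> X \<omega>"] by simp
      then show ?thesis using centered_gaussian_normal[of s] s False by auto
    qed
  qed
  have inta: "integrable M (\<lambda>\<omega>. a \<bullet> X \<omega>)" for a
  proof -
    obtain m where "centered_gaussian M (\<lambda>\<omega>. a \<bullet> X \<omega> - m)" using ex by auto
    from Bochner_Integration.integrable_add[OF centered_gaussian_integrable[OF this] integrable_const[of m]]
    show ?thesis by simp
  qed
  show int: "integrable M X" by (rule integrable_of_inner, subst inner_commute, rule inta)
  fix a
  obtain m where m: "centered_gaussian M (\<lambda>\<omega>. a \<bullet> X \<omega> - m)" using ex by auto
  then have "m = (LINT \<omega>|M. a \<bullet> X \<omega>)"
    using centered_gaussianD(3)[OF m] inta prob_space by simp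
  also have "\<dots> = a \<bullet> (LINT \<omega>|M. X \<omega>)" using int by simp
  finally show "centered_gaussian M (\<lambda>\<omega>. a \<bullet> (X \<omega> - (LINT \<omega>|M. X \<omega>)))"
    using m by (simp add: inner_diff_right)
qed

subsection \<open>Exit bounds from a drift condition\<close>

lemma has_derivative_gradient:
  assumes "h differentiable (at x)"
  shows "(h has_derivative (\<lambda>v. gradient h x \<bullet> v)) (at x)"
proof -
  let ?D = "frechet_derivative h (at x)"
  have D: "(h has_derivative ?D) (at x)" using assms by (simp add: frechet_derivative_works)
  interpret D: bounded_linear ?D using D by (rule has_derivative_bounded_linear)
  have "?D v = gradient h x \<bullet> v" for v
  proof -
    have "?D v = ?D (\<Sum>i\<in>UNIV. (v $ i) *\<^sub>R axis i 1)"
      using basis_expansion[of v] by (simp add: scalar_mult_eq_scaleR)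
    also have "\<dots> = (\<Sum>i\<in>UNIV. gradient h x $ i * v $ i)"
      by (simp add: D.sum D.scaleR gradient_def mult.commute)
    finally show ?thesis by (simp add: inner_vec_def)
  qed
  then have "?D = (\<lambda>v. gradient h x \<bullet> v)" by blast
  with D show ?thesis by simp
qed

lemma twice_continuously_differentiable_measurable:
  assumes "twice_continuously_differentiable h"
  shows "h \<in> borel_measurable borel" "gradient h \<in> borel_measurable borel"
  using assms unfolding twice_continuously_differentiable_def
  by (auto intro!: borel_measurable_continuous_onI continuous_at_imp_continuous_on differentiable_imp_continuous_within)

text \<open>Along the segment the second derivative is at least
  \<open>- L * (norm e)\<^sup>2\<close>, by the operator norm and Cauchy-Schwarz. Two monotonicity
  arguments take the place of a double integration.\<close>

lemma hessian_bound_taylor_lower: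
  assumes h: "twice_continuously_differentiable h"
    and L: "\<And>z. spectral_norm (hessian h z) \<le> L"
  shows "h z + gradient h z \<bullet> e - L / 2 * (norm e)\<^sup>2 \<le> h (z + e)"
proof -
  have d1: "(h has_derivative (\<lambda>v. gradient h x \<bullet> v)) (at x)" for x
    using h has_derivative_gradient by (auto simp: twice_continuously_differentiable_def)
  have d2: "(gradient h has_derivative (\<lambda>v. hessian h x *v v)) (at x)" for x
    using h by (auto simp: twice_continuously_differentiable_def hessian_def jacobian_works)
  have d3: "((\<lambda>t. z + t *\<^sub>R e) has_derivative (\<lambda>s. s *\<^sub>R e)) (at t)" for t
    by (auto intro!: derivative_eq_intros)
  define \<phi> where "\<phi> t = h (z + t *\<^sub>R e)" for t
  define \<psi> where "\<psi> t = gradient h (z + t *\<^sub>R e) \<bullet> e" for t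
  have \<phi>: "(\<phi> has_real_derivative \<psi> t) (at t)" for t
    using has_derivative_compose[OF d3 d1, of t]
    unfolding \<phi>_def \<psi>_def has_field_derivative_def by (simp add: mult_commute_abs)
  have \<psi>: "(\<psi> has_real_derivative (hessian h (z + t *\<^sub>R e) *v e) \<bullet> e) (at t)" for t
    using has_derivative_inner_left[OF has_derivative_compose[OF d3 d2, of t], of e]
    unfolding \<psi>_def has_field_derivative_def
    by (simp add: matrix_vector_mult_scaleR mult_commute_abs)
  have low: "(hessian h y *v e) \<bullet> e \<ge> - L * (norm e)\<^sup>2" for y
  proof -
    have "norm (hessian h y *v e) \<le> L * norm e"
      using onorm[OF matrix_vector_mul_bounded_linear[of "hessian h y"], of e] L[of y]
      unfolding spectral_norm_def by (meson mult_right_mono norm_ge_zero order_trans)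
    then have "norm (hessian h y *v e) * norm e \<le> L * norm e * norm e"
      by (intro mult_right_mono) auto
    then show ?thesis
      using Cauchy_Schwarz_ineq2[of "hessian h y *v e" e] by (simp add: power2_eq_square)
  qed
  define N where "N = (norm e)\<^sup>2"
  have g1: "\<psi> t - \<psi> 0 + L * N * t \<ge> 0" if "t \<ge> 0" for t
  proof -
    have "\<psi> 0 + L * N * 0 \<le> \<psi> t + L * N * t"
    proof (rule DERIV_nonneg_imp_nondecreasing[OF that])
      fix s
      have "((\<lambda>t. \<psi> t + L * N * t) has_real_derivative (hessian h (z + s *\<^sub>R e) *v e) \<bullet> e + L * N) (at s)"
        by (auto intro!: derivative_eq_intros \<psi>)
      then show "\<exists>y. ((\<lambda>t. \<psi> t + L * N * t) has_real_derivative y) (at s) \<and> 0 \<le> y"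
        using low[of "z + s *\<^sub>R e"] by (intro exI conjI) (auto simp: N_def)
    qed
    then show ?thesis by simp
  qed
  \<comment> \<open>The derivative of \<open>F\<close> is the expression shown nonnegative in
    \<open>g1\<close>, and \<open>F 0 \<le> F 1\<close> is the claim.\<close>
  define F where "F t = \<phi> t - t * \<psi> 0 + L * N / 2 * t\<^sup>2" for t
  have "F 0 \<le> F 1"
  proof (rule DERIV_nonneg_imp_nondecreasing[where f = F])
    fix s :: real assume "0 \<le> s" "s \<le> 1"
    moreover have "(F has_real_derivative \<psi> s - \<psi> 0 + L * N * s) (at s)"
      unfolding F_def by (auto intro!: derivative_eq_intros \<phi>)
    ultimately show "\<exists>y. (F has_real_derivative y) (at s) \<and> 0 \<le> y"
      using g1 by blast
  qed simp
  then show ?thesis by (simp add: F_def \<phi>_def \<psi>_def N_def)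
qed

text \<open>A step of \<open>1 / L\<close> times the gradient, which maximises the Taylor lower
  bound in that direction, raises \<open>h\<close> by at least the squared gradient norm over
  \<open>2 * L\<close>; the ceiling \<open>M\<close> limits this gain.\<close>

lemma gradient_bound_of_upper_bound:
  assumes h: "twice_continuously_differentiable h" and "L > 0"
    and L: "\<And>z. spectral_norm (hessian h z) \<le> L"
    and M: "\<And>z. h z \<le> M"
  shows "(norm (gradient h z))\<^sup>2 \<le> 2 * L * (M - h z)"
proof -
  let ?g = "gradient h z"
  have "h z + ?g \<bullet> ((1 / L) *\<^sub>R ?g) - L / 2 * (norm ((1 / L) *\<^sub>R ?g))\<^sup>2 \<le> M"
    using hessian_bound_taylor_lower[OF h L] M order_trans by blast
  also have "?g \<bullet> ((1 / L) *\<^sub>R ?g) = (norm ?g)\<^sup>2 / L" by (simp add: power2_norm_eq_inner)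
  also have "L / 2 * (norm ((1 / L) *\<^sub>R ?g))\<^sup>2 = (norm ?g)\<^sup>2 / L / 2"
    using \<open>L > 0\<close> by (simp add: power_divide power2_eq_square)
  finally have "(norm ?g)\<^sup>2 / L \<le> 2 * (M - h z)" by simp
  then show ?thesis using \<open>L > 0\<close> by (simp add: pos_divide_le_eq mult_ac)
qed

section \<open>Finite-time exit estimates\<close>

text \<open>On the survival event \<open>S k\<close> the value of \<open>V k\<close> lies between
  zero and one, whereas \<open>V k\<close> itself need not be integrable. The position of
  \<open>\<alpha> + \<beta>\<close> relative to one decides which potential of the surviving paths
  is propagated: \<open>a\<close> forward from below, or \<open>c\<close> from above.\<close>

lemma (in prob_space) exit_bounds_of_drift:
  fixes V :: "nat \<Rightarrow> 'a \<Rightarrow> real" and S :: "nat \<Rightarrow> 'a set"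
  defines "S \<equiv> (\<lambda>k. {\<omega> \<in> space M. \<forall>i\<le>k. V i \<omega> \<le> 1})"
  assumes meas [measurable]: "\<And>k. k \<le> T \<Longrightarrow> V k \<in> borel_measurable M"
    and nonneg: "\<And>k \<omega>. V k \<omega> \<ge> 0"
    and V0: "\<And>\<omega>. \<omega> \<in> space M \<Longrightarrow> V 0 \<omega> = v0"
    and \<alpha>: "0 < \<alpha>" "\<alpha> < 1"
    and int: "\<And>k. k < T \<Longrightarrow> integrable M (\<lambda>\<omega>. indicator (S k) \<omega> * V (Suc k) \<omega>)"
    and drift: "\<And>k. k < T \<Longrightarrow> (LINT \<omega>|M. indicator (S k) \<omega> * V (Suc k) \<omega>)
        \<le> (LINT \<omega>|M. indicator (S k) \<omega> * (\<alpha> * V k \<omega> + \<beta>))"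
  shows "\<alpha> + \<beta> \<le> 1 \<Longrightarrow> (1 - v0) * (1 - \<beta>) ^ T \<le> prob (S T)"
    and "1 \<le> \<alpha> + \<beta> \<Longrightarrow> 1 - prob (S T) \<le> v0 * \<alpha> ^ T + \<beta> * (\<Sum>i<T. \<alpha> ^ i)"
proof -
  have SM [measurable]: "S k \<in> sets M" if "k \<le> T" for k
  proof -
    have [measurable]: "V i \<in> borel_measurable M" if "i \<in> {..k}" for i using that \<open>k \<le> T\<close> meas by auto
    have "S k = {\<omega> \<in> space M. \<forall>i\<in>{..k}. V i \<omega> \<le> 1}" by (auto simp: S_def)
    also have "\<dots> \<in> sets M" by measurable
    finally show ?thesis .
  qed
  have iS: "integrable M (\<lambda>\<omega>. indicator (S k) \<omega> * V k \<omega>)" if "k \<le> T" for k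
    using that meas[OF that] SM[OF that] nonneg
    by (intro integrable_const_bound[where B = 1]) (auto simp: S_def indicator_def)
  have iI: "integrable M (indicat_real (S k))" if "k \<le> T" for k
    using SM[OF that] by (intro integrable_const_bound[where B = 1]) auto
  have ISi: "(LINT \<omega>|M. indicator (S k) \<omega> * (a * V k \<omega> + b)) = a * (LINT \<omega>|M. indicator (S k) \<omega> * V k \<omega>) + b * prob (S k)"
    if "k \<le> T" for a b k
  proof -
    have "(LINT \<omega>|M. indicator (S k) \<omega> * (a * V k \<omega> + b))
      = (LINT \<omega>|M. a * (indicator (S k) \<omega> * V k \<omega>) + b * indicator (S k) \<omega>)"
      by (simp add: algebra_simps)
    also have "\<dots> = a * (LINT \<omega>|M. indicator (S k) \<omega> * V k \<omega>) + b * prob (S k)"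
      using iS[OF that] iI[OF that] SM[OF that] by (subst Bochner_Integration.integral_add) auto
    finally show ?thesis .
  qed
  have dr: "(LINT \<omega>|M. indicator (S k) \<omega> * V (Suc k) \<omega>)
      \<le> \<alpha> * (LINT \<omega>|M. indicator (S k) \<omega> * V k \<omega>) + \<beta> * prob (S k)" if "k < T" for k
    using drift[OF that] ISi[of k \<alpha> \<beta>] that by simp
  have SS: "indicat_real (S (Suc k)) \<omega> = indicator (S k) \<omega> * (if V (Suc k) \<omega> \<le> 1 then 1 else 0)" for k \<omega>
    by (auto simp: S_def indicator_def le_Suc_eq)
  have S0: "LINT \<omega>|M. indicator (S 0) \<omega> * V 0 \<omega> = prob (S 0) * v0" "prob (S 0) = (if v0 \<le> 1 then 1 else 0)"
  proof -
    have "(LINT \<omega>|M. indicator (S 0) \<omega> * V 0 \<omega>) = (LINT \<omega>|M. indicator (S 0) \<omega> * v0)"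
      using V0 by (intro Bochner_Integration.integral_cong) auto
    then show "LINT \<omega>|M. indicator (S 0) \<omega> * V 0 \<omega> = prob (S 0) * v0" using SM[of 0] by simp
    have "S 0 = (if v0 \<le> 1 then space M else {})" using V0 by (auto simp: S_def)
    then show "prob (S 0) = (if v0 \<le> 1 then 1 else 0)" using prob_space by simp
  qed
  have v0: "v0 \<ge> 0" using V0 nonneg[of 0] not_empty by (metis all_not_in_conv)
  {
    assume ab: "\<alpha> + \<beta> \<le> 1"
    \<comment> \<open>This is the integral of \<open>1 - V k\<close> over surviving paths. Each step
      keeps at least the fraction \<open>1 - \<beta>\<close>, and \<open>V\<close> being nonnegative
      it stays below the survival probability.\<close>
    define a where "a k = prob (S k) - (LINT \<omega>|M. indicator (S k) \<omega> * V k \<omega>)" for k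
    have "(1 - v0) * (1 - \<beta>) ^ k \<le> a k" if "k \<le> T" for k
      using that
    proof (induction k)
      case 0
      then show ?case using S0 by (simp add: a_def)
    next
      case (Suc k)
      have k: "k < T" "k \<le> T" "Suc k \<le> T" using Suc.prems by auto
      have "(1 - v0) * (1 - \<beta>) ^ Suc k \<le> (1 - \<beta>) * a k"
        using mult_left_mono[OF Suc.IH, of "1 - \<beta>"] k ab \<alpha> by (simp add: mult_ac)
      also have "\<dots> = prob (S k) - (\<beta> * prob (S k) + (1 - \<beta>) * (LINT \<omega>|M. indicator (S k) \<omega> * V k \<omega>))"
        by (simp add: a_def algebra_simps)
      \<comment> \<open>Lowering the coefficient from \<open>1 - \<beta>\<close> to
        \<open>\<alpha>\<close> is where the case hypothesis enters.\<close>
      also have "\<dots> \<le> prob (S k) - (\<beta> * prob (S k) + \<alpha> * (LINT \<omega>|M. indicator (S k) \<omega> * V k \<omega>))"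
        using ab nonneg by (intro diff_left_mono add_left_mono mult_right_mono) auto
      also have "\<dots> \<le> prob (S k) - (LINT \<omega>|M. indicator (S k) \<omega> * V (Suc k) \<omega>)"
        using dr[OF k(1)] by simp
      also have "\<dots> = (LINT \<omega>|M. indicator (S k) \<omega> - indicator (S k) \<omega> * V (Suc k) \<omega>)"
        using int[OF k(1)] iI[OF k(2)] SM[OF k(2)] by simp
      \<comment> \<open>Paths that leave at time \<open>Suc k\<close> have a negative
        \<open>1 - V (Suc k) \<omega>\<close>, so discarding them increases the integral.\<close>
      also have "\<dots> \<le> (LINT \<omega>|M. indicator (S (Suc k)) \<omega> - indicator (S (Suc k)) \<omega> * V (Suc k) \<omega>)"
        using int[OF k(1)] iI[OF k(2)] iI[OF k(3)] iS[OF k(3)]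
        by (intro integral_mono Bochner_Integration.integrable_diff) (assumption | simp add: SS split: split_indicator)+
      also have "\<dots> = a (Suc k)"
        using iI[OF k(3)] iS[OF k(3)] SM[OF k(3)] by (simp add: a_def)
      finally show ?case .
    qed
    from this[of T] have "(1 - v0) * (1 - \<beta>) ^ T \<le> a T" by simp
    also have "a T \<le> prob (S T)" using nonneg by (simp add: a_def)
    finally show "(1 - v0) * (1 - \<beta>) ^ T \<le> prob (S T)" .
  }
  {
    assume ab: "1 \<le> \<alpha> + \<beta>"
    \<comment> \<open>\<open>\<alpha> ^ j * r + \<beta> * s j\<close> bounds the probability of leaving in \<open>j\<close> further steps from level \<open>r\<close>.\<close>
    define s where "s j = (\<Sum>i<j. \<alpha> ^ i)" for j :: nat
    have s0: "s j \<ge> 0" for j using \<alpha> by (auto simp: s_def intro!: sum_nonneg)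
    \<comment> \<open>From level one upwards the affine bound is at least one, because
      \<open>1 = \<alpha> ^ j + (1 - \<alpha>) * s j\<close> and
      \<open>1 - \<alpha> \<le> \<beta>\<close>.\<close>
    have q1: "1 \<le> \<alpha> ^ j * r + \<beta> * s j" if "r \<ge> 1" for j r
    proof -
      have "1 = \<alpha> ^ j + (1 - \<alpha>) * s j"
        using one_diff_power_eq[of \<alpha> j] by (simp add: s_def)
      also have "\<dots> \<le> \<alpha> ^ j * r + \<beta> * s j"
        using that \<alpha> ab s0 by (intro add_mono mult_right_mono) auto
      finally show ?thesis .
    qed
    \<comment> \<open>Paths that have left count as one, survivors through the affine bound with
      \<open>T - k\<close> steps to go. This does not increase in \<open>k\<close>, and at
      \<open>k = T\<close> it dominates the exit probability.\<close>
    define c where "c k = 1 - prob (S k) + (\<alpha> ^ (T - k) * (LINT \<omega>|M. indicator (S k) \<omega> * V k \<omega>) + \<beta> * s (T - k) * prob (S k))" for k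
    have "c k \<le> \<alpha> ^ T * v0 + \<beta> * s T" if "k \<le> T" for k
      using that
    proof (induction k)
      case 0
      \<comment> \<open>If \<open>v0\<close> exceeds one, \<open>S 0\<close> is empty and
        \<open>c 0 = 1\<close>; \<open>q1\<close> covers this case.\<close>
      then show ?case using q1[of v0 T] S0 by (simp add: c_def)
    next
      case (Suc k)
      have k: "k < T" "k \<le> T" "Suc k \<le> T" using Suc.prems by auto
      define j where "j = T - Suc k"
      have j: "T - k = Suc j" using k by (simp add: j_def)
      have "c (Suc k) = (LINT \<omega>|M. (1 - indicator (S (Suc k)) \<omega>) + (\<alpha> ^ j * (indicator (S (Suc k)) \<omega> * V (Suc k) \<omega>) + \<beta> * s j * indicator (S (Suc k)) \<omega>))"
        using iI[OF k(3)] iS[OF k(3)] SM[OF k(3)] prob_space by (simp add: c_def j_def)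
      \<comment> \<open>Enlarging \<open>S (Suc k)\<close> to \<open>S k\<close> trades the value
        one of the newly lost paths for their affine bound, which is at least one by
        \<open>q1\<close>.\<close>
      also have "\<dots> \<le> (LINT \<omega>|M. (1 - indicator (S k) \<omega>) + (\<alpha> ^ j * (indicator (S k) \<omega> * V (Suc k) \<omega>) + \<beta> * s j * indicator (S k) \<omega>))"
        using int[OF k(1)] iI[OF k(2)] iI[OF k(3)] iS[OF k(3)] q1[of "V (Suc k) _" j]
        by (intro integral_mono Bochner_Integration.integrable_diff Bochner_Integration.integrable_add integrable_mult_right)
          (assumption | simp add: SS split: split_indicator)+
      also have "\<dots> = 1 - prob (S k) + (\<alpha> ^ j * (LINT \<omega>|M. indicator (S k) \<omega> * V (Suc k) \<omega>) + \<beta> * s j * prob (S k))"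
        using int[OF k(1)] iI[OF k(2)] SM[OF k(2)] prob_space by simp
      also have "\<dots> \<le> 1 - prob (S k) + (\<alpha> ^ j * (\<alpha> * (LINT \<omega>|M. indicator (S k) \<omega> * V k \<omega>) + \<beta> * prob (S k)) + \<beta> * s j * prob (S k))"
        using dr[OF k(1)] \<alpha> by (intro add_left_mono add_right_mono mult_left_mono) auto
      also have "\<dots> = c k" by (simp add: c_def j s_def algebra_simps)
      finally show ?case using Suc.IH k by simp
    qed
    from this[of T] have "1 - prob (S T) + (LINT \<omega>|M. indicator (S T) \<omega> * V T \<omega>) \<le> \<alpha> ^ T * v0 + \<beta> * s T"
      by (simp add: c_def s_def)
    moreover have "(LINT \<omega>|M. indicator (S T) \<omega> * V T \<omega>) \<ge> 0" using nonneg by simp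
    ultimately show "1 - prob (S T) \<le> v0 * \<alpha> ^ T + \<beta> * (\<Sum>i<T. \<alpha> ^ i)" by (simp add: s_def mult_ac)
  }
qed

subsection \<open>Innovations of the Kalman filter\<close>

lemma inner_matrix_vector: "a \<bullet> (A *v b) = (transpose A *v a) \<bullet> (b :: real^'n)"
  by (simp add: dot_lmul_matrix transpose_matrix_vector)

lemma borel_measurable_matrix_vector_mult [measurable (raw)]:
  fixes A :: "real^'n^'m"
  shows "X \<in> borel_measurable N \<Longrightarrow> (\<lambda>\<omega>. A *v X \<omega>) \<in> borel_measurable N"
  by (rule measurable_compose[of _ _ borel])
    (auto intro!: borel_measurable_continuous_onI linear_continuous_on matrix_vector_mul_bounded_linear)

lemma borel_measurable_vecI:
  fixes X :: "'a \<Rightarrow> real^'n"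
  assumes "\<And>i. (\<lambda>\<omega>. X \<omega> $ i) \<in> borel_measurable N"
  shows "X \<in> borel_measurable N"
proof (subst borel_measurable_euclidean_space, rule ballI)
  fix b :: "real^'n" assume "b \<in> Basis"
  then obtain i where "b = axis i 1" by (auto simp: Basis_vec_def)
  then show "(\<lambda>\<omega>. X \<omega> \<bullet> b) \<in> borel_measurable N"
    using assms[of i] by (simp add: inner_axis)
qed

lemma matrix_inv_mult: "invertible S \<Longrightarrow> matrix_inv S ** S = mat 1"
  unfolding invertible_def matrix_inv_def by (rule someI2_ex) auto

lemma trace_eq_sum_axis: "trace (A :: real^'n^'n) = (\<Sum>i\<in>UNIV. axis i 1 \<bullet> (A *v axis i 1))"
  by (simp add: trace_def matrix_vector_mult_basis inner_axis' column_def)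

text \<open>Square integrability of the projections makes every entry of the outer product
  integrable, so the matrix-valued integral can be read entrywise.\<close>

lemma second_moment_inner:
  assumes X [measurable]: "X \<in> borel_measurable M"
    and sq: "\<And>a. integrable M (\<lambda>\<omega>. (a \<bullet> X \<omega>)\<^sup>2)"
  shows "(LINT \<omega>|M. (a \<bullet> X \<omega>) * (b \<bullet> X \<omega>)) = a \<bullet> (second_moment M X *v b)"
proof -
  have sqi: "integrable M (\<lambda>\<omega>. (X \<omega> $ i)\<^sup>2)" for i
    using sq[of "axis i 1"] by (simp add: inner_axis')
  have ij: "integrable M (\<lambda>\<omega>. X \<omega> $ i * X \<omega> $ j)" for i j
    by (rule integrable_mult_of_squares) (simp_all add: sqi measurable_compose[OF X borel_measurable_nth])
  have "integrable M (\<lambda>\<omega>. outer (X \<omega>) \<bullet> axis i (axis j 1))" for i j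
    using ij[of i j] by (simp add: inner_axis outer_def)
  then have "integrable M (\<lambda>\<omega>. \<Sum>b\<in>Basis. (outer (X \<omega>) \<bullet> b) *\<^sub>R b)"
    by (intro Bochner_Integration.integrable_sum integrable_scaleR_left) (auto simp: Basis_vec_def)
  then have io: "integrable M (\<lambda>\<omega>. outer (X \<omega>))" by (simp add: euclidean_representation)
  have entry: "second_moment M X $ i $ j = (LINT \<omega>|M. X \<omega> $ i * X \<omega> $ j)" for i j
  proof -
    have "(LINT \<omega>|M. outer (X \<omega>) \<bullet> axis i (axis j 1)) = second_moment M X \<bullet> axis i (axis j 1)"
      using io unfolding second_moment_def by (rule integral_inner_left)
    then show ?thesis by (simp add: inner_axis outer_def)
  qed
  have "(a \<bullet> X \<omega>) * (b \<bullet> X \<omega>) = (\<Sum>i\<in>UNIV. \<Sum>j\<in>UNIV. a $ i * b $ j * (X \<omega> $ i * X \<omega> $ j))" for \<omega>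
    by (simp add: inner_vec_def sum_product mult_ac)
  then have "(LINT \<omega>|M. (a \<bullet> X \<omega>) * (b \<bullet> X \<omega>))
      = (\<Sum>i\<in>UNIV. \<Sum>j\<in>UNIV. a $ i * b $ j * second_moment M X $ i $ j)"
    using ij by (simp add: entry)
  also have "\<dots> = a \<bullet> (second_moment M X *v b)"
    by (simp add: inner_vec_def matrix_vector_mult_def sum_distrib_left mult_ac)
  finally show ?thesis .
qed

lemma centered_gaussian_cong:
  assumes "\<And>\<omega>. \<omega> \<in> space M \<Longrightarrow> X \<omega> = Y \<omega>"
  shows "centered_gaussian M X \<longleftrightarrow> centered_gaussian M Y"
  unfolding centered_gaussian_def using assms
  by (intro conj_cong arg_cong2[of _ _ _ _ "(=)"] measurable_cong Bochner_Integration.integrable_cong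
      Bochner_Integration.integral_cong arg_cong[of _ _ "\<lambda>z. complex_of_real (exp (- z / 2))"]) auto

lemma centered_gaussian_mult_expand:
  assumes "centered_gaussian M X" "centered_gaussian M Y" "centered_gaussian M Z"
  shows "(LINT \<omega>|M. (X \<omega> + Y \<omega>) * Z \<omega>) = (LINT \<omega>|M. X \<omega> * Z \<omega>) + (LINT \<omega>|M. Y \<omega> * Z \<omega>)"
    "(LINT \<omega>|M. (X \<omega> - Y \<omega>) * Z \<omega>) = (LINT \<omega>|M. X \<omega> * Z \<omega>) - (LINT \<omega>|M. Y \<omega> * Z \<omega>)"
    "(LINT \<omega>|M. Z \<omega> * (X \<omega> + Y \<omega>)) = (LINT \<omega>|M. Z \<omega> * X \<omega>) + (LINT \<omega>|M. Z \<omega> * Y \<omega>)"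
    "(LINT \<omega>|M. Z \<omega> * (X \<omega> - Y \<omega>)) = (LINT \<omega>|M. Z \<omega> * X \<omega>) - (LINT \<omega>|M. Z \<omega> * Y \<omega>)"
proof -
  note i = integrable_mult_of_squares[OF centered_gaussianD(1,1,2,2)]
  note i = i[OF assms(1,3,1,3)] i[OF assms(2,3,2,3)]
  show "(LINT \<omega>|M. (X \<omega> + Y \<omega>) * Z \<omega>) = (LINT \<omega>|M. X \<omega> * Z \<omega>) + (LINT \<omega>|M. Y \<omega> * Z \<omega>)"
    "(LINT \<omega>|M. (X \<omega> - Y \<omega>) * Z \<omega>) = (LINT \<omega>|M. X \<omega> * Z \<omega>) - (LINT \<omega>|M. Y \<omega> * Z \<omega>)"
    "(LINT \<omega>|M. Z \<omega> * (X \<omega> + Y \<omega>)) = (LINT \<omega>|M. Z \<omega> * X \<omega>) + (LINT \<omega>|M. Z \<omega> * Y \<omega>)"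
    "(LINT \<omega>|M. Z \<omega> * (X \<omega> - Y \<omega>)) = (LINT \<omega>|M. Z \<omega> * X \<omega>) - (LINT \<omega>|M. Z \<omega> * Y \<omega>)"
    using i by (simp_all add: distrib_right left_diff_distrib mult.commute[of "Z _"])
qed

declare transpose_matrix_vector [simp del]

text \<open>Filter and noises are separated from the barrier function. \<open>xhat_ce\<close>
  supplies measurability of the estimate with respect to past measurements and, at time zero, the
  mean of \<open>x 0\<close>; orthogonality of errors and innovations comes from the gain.\<close>

locale kalman_filter = prob_space \<Omega>
  for \<Omega> :: "'a measure" +
  fixes A :: "nat \<Rightarrow> real^'n^'n" and B :: "nat \<Rightarrow> real^'m^'n" and C :: "nat \<Rightarrow> real^'n^'p"
    and x xhat w :: "nat \<Rightarrow> 'a \<Rightarrow> real^'n"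
    and y v :: "nat \<Rightarrow> 'a \<Rightarrow> real^'p"
    and u :: "nat \<Rightarrow> 'a \<Rightarrow> real^'m"
    and Q P :: "nat \<Rightarrow> real^'n^'n" and R :: "nat \<Rightarrow> real^'p^'p" and K :: "nat \<Rightarrow> real^'p^'n"
    and xhat0 :: "real^'n"
    and T :: nat
  assumes x0_gauss: "gaussian_vector \<Omega> (x 0)"
    and w_gauss: "\<And>k. gaussian_vector \<Omega> (w k)"
    and v_gauss: "\<And>k. gaussian_vector \<Omega> (v k)"
    and w_mean: "\<And>k. (LINT \<omega>|\<Omega>. w k \<omega>) = 0"
    and v_mean: "\<And>k. (LINT \<omega>|\<Omega>. v k \<omega>) = 0"
    and indep: "indep_sets (source_events \<Omega> (x 0) w v) UNIV"
    and sys_x: "\<And>k \<omega>. k < T \<Longrightarrow> \<omega> \<in> space \<Omega> \<Longrightarrow> x (Suc k) \<omega> = A k *v x k \<omega> + B k *v u k \<omega> + w k \<omega>"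
    and sys_y: "\<And>k \<omega>. k < T \<Longrightarrow> \<omega> \<in> space \<Omega> \<Longrightarrow> y k \<omega> = C k *v x k \<omega> + v k \<omega>"
    and Q: "\<And>k. Q k = second_moment \<Omega> (w k)"
    and R: "\<And>k. R k = second_moment \<Omega> (v k)"
    and P: "\<And>k. P k = error_cov A C Q R (second_moment \<Omega> (\<lambda>\<omega>. x 0 \<omega> - xhat 0 \<omega>)) k"
    and inv: "\<And>k. k < T \<Longrightarrow> invertible (innovation_cov (C k) (R k) (P k))"
    and K: "\<And>k. K k = kalman_gain (A k) (C k) (R k) (P k)"
    and xhat_init: "\<And>\<omega>. \<omega> \<in> space \<Omega> \<Longrightarrow> xhat 0 \<omega> = xhat0"
    and xhat_step: "\<And>k \<omega>. k < T \<Longrightarrow> \<omega> \<in> space \<Omega> \<Longrightarrow>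
           xhat (Suc k) \<omega> = A k *v xhat k \<omega> + B k *v u k \<omega> + K k *v (y k \<omega> - C k *v xhat k \<omega>)"
    and xhat_ce: "\<And>k. k \<le> T \<Longrightarrow> is_cond_exp \<Omega> (past_measurements \<Omega> y k) (x k) (xhat k)"
    and u_meas: "\<And>k. k < T \<Longrightarrow> u k \<in> borel_measurable (past_measurements \<Omega> y k)"
begin

section \<open>Filtration of the measurements\<close>

abbreviation F :: "nat \<Rightarrow> 'a measure" where "F k \<equiv> past_measurements \<Omega> y k"

lemma space_F [simp]: "space (F k) = space \<Omega>"
  by (simp add: past_measurements_def space_measure_of_conv)

lemma xhat_F_measurable: "k \<le> T \<Longrightarrow> xhat k \<in> borel_measurable (F k)"
  using xhat_ce by (simp add: is_cond_exp_def)

lemma source_measurable [measurable]: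
  "x 0 \<in> borel_measurable \<Omega>" "w k \<in> borel_measurable \<Omega>" "v k \<in> borel_measurable \<Omega>"
  using x0_gauss w_gauss v_gauss by (auto simp: gaussian_vector_def)

lemma sets_F:
  "sets (F k) = sigma_sets (space \<Omega>) (\<Union>i<k. {y i -` E \<inter> space \<Omega> | E. E \<in> sets borel})"
  unfolding past_measurements_def by (rule sets_measure_of) auto

lemma subalgebra_F_mono: "i \<le> k \<Longrightarrow> subalgebra (F k) (F i)"
  unfolding subalgebra_def sets_F by (intro conjI sigma_sets_subseteq UN_mono) auto

lemma sets_F_subset_of_measurable:
  assumes "\<And>i. i < k \<Longrightarrow> y i \<in> borel_measurable N" "space N = space \<Omega>"
  shows "sets (F k) \<subseteq> sets N"
proof -
  have gen: "(\<Union>i<k. {y i -` E \<inter> space \<Omega> | E. E \<in> sets borel}) \<subseteq> sets N"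
    using measurable_sets[OF assms(1)] assms(2) by auto
  then show ?thesis using sets.sigma_sets_subset[OF gen] assms(2) by (simp add: sets_F)
qed

text \<open>State and measurements are treated together: the input at \<open>k\<close> is known to
  be measurable in \<open>\<Omega>\<close> only once the generators \<open>y i\<close>,
  \<open>i < k\<close>, of \<open>F k\<close> are.\<close>

lemma x_y_measurable:
  "k \<le> T \<Longrightarrow> x k \<in> borel_measurable \<Omega> \<and> (\<forall>i<k. y i \<in> borel_measurable \<Omega>)"
proof (induction k)
  case 0
  then show ?case by simp
next
  case (Suc k)
  then have k: "k < T" and [measurable]: "x k \<in> borel_measurable \<Omega>"
    and y: "\<And>i. i < k \<Longrightarrow> y i \<in> borel_measurable \<Omega>" by auto
  have yk: "y k \<in> borel_measurable \<Omega>"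
    by (subst measurable_cong[OF sys_y[OF k]]) auto
  have "sets (F k) \<subseteq> sets \<Omega>" using sets_F_subset_of_measurable[OF y] by simp
  then have "subalgebra \<Omega> (F k)" by (simp add: subalgebra_def)
  then have [measurable]: "u k \<in> borel_measurable \<Omega>" by (rule measurable_from_subalg[OF _ u_meas[OF k]])
  have "x (Suc k) \<in> borel_measurable \<Omega>"
    by (subst measurable_cong[OF sys_x[OF k]]) auto
  then show ?case using y yk by (auto simp: less_Suc_eq)
qed

lemma x_measurable: "k \<le> T \<Longrightarrow> x k \<in> borel_measurable \<Omega>"
  using x_y_measurable by blast

lemma subalgebra_F: "k \<le> T \<Longrightarrow> subalgebra \<Omega> (F k)"
  unfolding subalgebra_def using sets_F_subset_of_measurable[of k \<Omega>] x_y_measurable[of k] by simp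

lemma F_measurable: "k \<le> T \<Longrightarrow> X \<in> measurable (F k) N \<Longrightarrow> X \<in> measurable \<Omega> N"
  using measurable_from_subalg subalgebra_F by blast

lemma xhat_measurable: "k \<le> T \<Longrightarrow> xhat k \<in> borel_measurable \<Omega>"
  using F_measurable xhat_F_measurable by blast

text \<open>Integrating a conditional expectation returns the mean, and here it is the constant
  \<open>xhat0\<close>. The initial error is thereby centred, like the noises.\<close>

lemma x0_mean: "(LINT \<omega>|\<Omega>. x 0 \<omega>) = xhat0"
proof -
  note int = gaussian_vector_centered(1)[OF x0_gauss]
  interpret F0: finite_measure_subalgebra \<Omega> "F 0"
    by unfold_locales (rule subalgebra_F, simp)
  have "(LINT \<omega>|\<Omega>. x 0 \<omega>) $ i = xhat0 $ i" for i
  proof -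
    have ci: "integrable \<Omega> (\<lambda>\<omega>. x 0 \<omega> $ i)"
      using integrable_inner_left[OF int, of "axis i 1"] by (simp add: inner_axis)
    have "AE \<omega> in \<Omega>. real_cond_exp \<Omega> (F 0) (\<lambda>\<omega>. x 0 \<omega> $ i) \<omega> = xhat 0 \<omega> $ i"
      using xhat_ce[of 0] by (simp add: is_cond_exp_def)
    then have "AE \<omega> in \<Omega>. real_cond_exp \<Omega> (F 0) (\<lambda>\<omega>. x 0 \<omega> $ i) \<omega> = xhat0 $ i"
      using AE_space by eventually_elim (simp add: xhat_init)
    then have "(LINT \<omega>|\<Omega>. real_cond_exp \<Omega> (F 0) (\<lambda>\<omega>. x 0 \<omega> $ i) \<omega>) = (LINT \<omega>|\<Omega>. xhat0 $ i)"
      by (intro integral_cong_AE) auto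
    then have "(LINT \<omega>|\<Omega>. x 0 \<omega> $ i) = xhat0 $ i"
      using F0.real_cond_exp_int(2)[OF ci] prob_space by simp
    moreover have "(LINT \<omega>|\<Omega>. x 0 \<omega> \<bullet> axis i 1) = (LINT \<omega>|\<Omega>. x 0 \<omega>) \<bullet> axis i 1"
      using int by (rule integral_inner_left)
    ultimately show ?thesis by (simp add: inner_axis)
  qed
  then show ?thesis by (simp add: vec_eq_iff)
qed

section \<open>Linear functionals of the independent sources\<close>

text \<open>Scalar projections put sources from spaces of different dimension into one type. The
  initial state is centred so that every functional has mean zero.\<close>

fun source_functionals :: "source \<Rightarrow> ('a \<Rightarrow> real) set" where
  "source_functionals Initial = {\<lambda>\<omega>. a \<bullet> (x 0 \<omega> - xhat0) | a. True}"
| "source_functionals (Disturbance k) = {\<lambda>\<omega>. a \<bullet> w k \<omega> | a. True}"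
| "source_functionals (Noise k) = {\<lambda>\<omega>. a \<bullet> v k \<omega> | a. True}"

lemma source_functional_add:
  "Y \<in> source_functionals s \<Longrightarrow> Z \<in> source_functionals s \<Longrightarrow> (\<lambda>\<omega>. Y \<omega> + Z \<omega>) \<in> source_functionals s"
  by (cases s) (auto simp: inner_add_left[symmetric])

lemma source_functional_scale:
  "Y \<in> source_functionals s \<Longrightarrow> (\<lambda>\<omega>. c * Y \<omega>) \<in> source_functionals s"
  by (cases s) (auto simp: inner_scaleR_left[symmetric] simp del: inner_scaleR_left)

lemma source_functional_zero: "(\<lambda>\<omega>. 0) \<in> source_functionals s"
  by (cases s) (auto intro!: exI[of _ 0])

lemma source_functional_gaussian:
  "Y \<in> source_functionals s \<Longrightarrow> centered_gaussian \<Omega> Y"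
  using gaussian_vector_centered(2)[OF x0_gauss] gaussian_vector_centered(2)[OF w_gauss]
    gaussian_vector_centered(2)[OF v_gauss]
  by (cases s) (auto simp: x0_mean w_mean v_mean)

lemma source_functional_events:
  assumes "Y \<in> source_functionals s" "E \<in> sets borel"
  shows "Y -` E \<inter> space \<Omega> \<in> source_events \<Omega> (x 0) w v s"
proof -
  have *: "Y -` E \<inter> space \<Omega> \<in> sets (vimage_algebra (space \<Omega>) Z borel)"
    if "Y = (\<lambda>\<omega>. a \<bullet> (Z \<omega> - b))" for Z :: "'a \<Rightarrow> 'b::euclidean_space" and a b
  proof -
    have [measurable]: "Z \<in> borel_measurable (vimage_algebra (space \<Omega>) Z borel)"
      by (rule measurable_vimage_algebra1) auto
    have "Y \<in> borel_measurable (vimage_algebra (space \<Omega>) Z borel)"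
      unfolding that by measurable
    from measurable_sets[OF this assms(2)] show ?thesis by simp
  qed
  show ?thesis
    using assms(1) *[of _ "x 0" xhat0] *[of _ "w _" 0] *[of _ "v _" 0] by (cases s) auto
qed

lemma source_functionals_indep:
  assumes "\<And>s. Z s \<in> source_functionals s"
  shows "indep_vars (\<lambda>_. borel) Z UNIV"
  unfolding indep_vars_def2
proof (intro conjI ballI)
  show "random_variable borel (Z s)" for s
    using centered_gaussianD(1)[OF source_functional_gaussian[OF assms]] .
  show "indep_sets (\<lambda>s. {Z s -` E \<inter> space \<Omega> |E. E \<in> sets borel}) UNIV"
    by (rule indep_sets_mono_sets[OF indep]) (auto intro!: source_functional_events assms)
qed

lemma source_functionals_uncorrelated:
  assumes "Y \<in> source_functionals s" "Z \<in> source_functionals t" "s \<noteq> t"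
  shows "(LINT \<omega>|\<Omega>. Y \<omega> * Z \<omega>) = 0"
proof -
  \<comment> \<open>Zero functionals complete \<open>Y\<close> and \<open>Z\<close> to a family over
    all sources.\<close>
  let ?Z = "\<lambda>r. if r = s then Y else if r = t then Z else (\<lambda>\<omega>. 0)"
  have "indep_vars (\<lambda>_. borel) ?Z UNIV"
    by (rule source_functionals_indep) (use assms source_functional_zero in auto)
  from indep_vars_expectation_mult[OF this, of s t] assms(3) show ?thesis
    using centered_gaussian_integrable[OF source_functional_gaussian[OF assms(1)]]
      centered_gaussian_integrable[OF source_functional_gaussian[OF assms(2)]]
      centered_gaussianD(3)[OF source_functional_gaussian[OF assms(1)]] by simp
qed

text \<open>The index follows the filter: the error at \<open>k\<close> depends on the sources
  before \<open>k\<close>, while the innovation at \<open>k\<close> also contains \<open>v k\<close>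
  and needs \<open>Suc k\<close>.\<close>

definition sources_before :: "nat \<Rightarrow> source set" where
  "sources_before N = insert Initial (Disturbance ` {..<N} \<union> Noise ` {..<N})"

text \<open>Equality is only required on \<open>space \<Omega>\<close>, since the system equations hold only there.\<close>

definition linear_functionals :: "nat \<Rightarrow> ('a \<Rightarrow> real) set" where
  "linear_functionals N = {Y. \<exists>Z. (\<forall>s. Z s \<in> source_functionals s) \<and>
     (\<forall>\<omega>\<in>space \<Omega>. Y \<omega> = (\<Sum>s\<in>sources_before N. Z s \<omega>))}"

lemma finite_sources_before [simp]: "finite (sources_before N)"
  by (simp add: sources_before_def)

lemma linear_functionals_cong:
  "Y \<in> linear_functionals N \<Longrightarrow> (\<And>\<omega>. \<omega> \<in> space \<Omega> \<Longrightarrow> Y' \<omega> = Y \<omega>) \<Longrightarrow> Y' \<in> linear_functionals N"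
  by (auto simp: linear_functionals_def)

lemma linear_functionals_add:
  assumes "X \<in> linear_functionals N" "Y \<in> linear_functionals N"
  shows "(\<lambda>\<omega>. X \<omega> + Y \<omega>) \<in> linear_functionals N"
proof -
  obtain Z Z' where "\<And>s. Z s \<in> source_functionals s" "\<And>s. Z' s \<in> source_functionals s"
    "\<And>\<omega>. \<omega> \<in> space \<Omega> \<Longrightarrow> X \<omega> = (\<Sum>s\<in>sources_before N. Z s \<omega>)"
    "\<And>\<omega>. \<omega> \<in> space \<Omega> \<Longrightarrow> Y \<omega> = (\<Sum>s\<in>sources_before N. Z' s \<omega>)"
    using assms unfolding linear_functionals_def by blast
  then show ?thesis unfolding linear_functionals_def
    by (auto intro!: exI[of _ "\<lambda>s \<omega>. Z s \<omega> + Z' s \<omega>"] source_functional_add simp: sum.distrib)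
qed

lemma linear_functionals_scale:
  assumes "X \<in> linear_functionals N"
  shows "(\<lambda>\<omega>. c * X \<omega>) \<in> linear_functionals N"
proof -
  obtain Z where "\<And>s. Z s \<in> source_functionals s"
    "\<And>\<omega>. \<omega> \<in> space \<Omega> \<Longrightarrow> X \<omega> = (\<Sum>s\<in>sources_before N. Z s \<omega>)"
    using assms unfolding linear_functionals_def by blast
  then show ?thesis unfolding linear_functionals_def
    by (auto intro!: exI[of _ "\<lambda>s \<omega>. c * Z s \<omega>"] source_functional_scale simp: sum_distrib_left)
qed

lemma linear_functionals_diff:
  assumes "X \<in> linear_functionals N" "Y \<in> linear_functionals N"
  shows "(\<lambda>\<omega>. X \<omega> - Y \<omega>) \<in> linear_functionals N"
  using linear_functionals_add[OF assms(1) linear_functionals_scale[OF assms(2), of "-1"]] by simp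

lemma linear_functionals_source:
  assumes "Y \<in> source_functionals s" "s \<in> sources_before N"
  shows "Y \<in> linear_functionals N"
  unfolding linear_functionals_def using assms source_functional_zero
  by (auto intro!: exI[of _ "\<lambda>r. if r = s then Y else (\<lambda>_. 0)"] simp: if_distribR if_distrib sum.delta cong: if_cong)

lemma linear_functionals_sum:
  assumes "finite J" "\<And>j. j \<in> J \<Longrightarrow> Y j \<in> linear_functionals N"
  shows "(\<lambda>\<omega>. \<Sum>j\<in>J. Y j \<omega>) \<in> linear_functionals N"
  using assms
proof (induction J rule: finite_induct)
  case empty
  show ?case using linear_functionals_source[OF source_functional_zero, of Initial N]
    by (simp add: sources_before_def)
next
  case (insert j J)
  then show ?case by (simp add: linear_functionals_add)
qed

lemma linear_functionals_mono:
  assumes "Y \<in> linear_functionals N" "N \<le> N'"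
  shows "Y \<in> linear_functionals N'"
proof -
  obtain Z where Z: "\<And>s. Z s \<in> source_functionals s"
    "\<And>\<omega>. \<omega> \<in> space \<Omega> \<Longrightarrow> Y \<omega> = (\<Sum>s\<in>sources_before N. Z s \<omega>)"
    using assms unfolding linear_functionals_def by blast
  have "(\<lambda>\<omega>. \<Sum>s\<in>sources_before N. Z s \<omega>) \<in> linear_functionals N'"
    using assms(2) by (intro linear_functionals_sum linear_functionals_source[OF Z(1)])
      (auto simp: sources_before_def)
  then show ?thesis using Z(2) by (rule linear_functionals_cong)
qed

lemma linear_functionals_gaussian:
  assumes "Y \<in> linear_functionals N"
  shows "centered_gaussian \<Omega> Y"
proof -
  obtain Z where Z: "\<And>s. Z s \<in> source_functionals s"
    "\<And>\<omega>. \<omega> \<in> space \<Omega> \<Longrightarrow> Y \<omega> = (\<Sum>s\<in>sources_before N. Z s \<omega>)"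
    using assms unfolding linear_functionals_def by blast
  have "centered_gaussian \<Omega> (\<lambda>\<omega>. \<Sum>s\<in>sources_before N. Z s \<omega>)"
    using source_functionals_indep[OF Z(1)] source_functional_gaussian[OF Z(1)]
    by (intro centered_gaussian_indep_sum(1)) (auto intro: indep_vars_subset)
  then show ?thesis using centered_gaussian_cong[of \<Omega> Y, OF Z(2)] by simp
qed

lemma linear_functionals_uncorrelated:
  assumes "Y \<in> linear_functionals N" "Z \<in> source_functionals s" "s \<notin> sources_before N"
  shows "(LINT \<omega>|\<Omega>. Y \<omega> * Z \<omega>) = 0" "(LINT \<omega>|\<Omega>. Z \<omega> * Y \<omega>) = 0"
proof -
  obtain X where X: "\<And>s. X s \<in> source_functionals s"
    "\<And>\<omega>. \<omega> \<in> space \<Omega> \<Longrightarrow> Y \<omega> = (\<Sum>s\<in>sources_before N. X s \<omega>)"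
    using assms(1) unfolding linear_functionals_def by blast
  have "integrable \<Omega> (\<lambda>\<omega>. X r \<omega> * Z \<omega>)" for r
    by (intro integrable_mult_of_squares centered_gaussianD source_functional_gaussian[OF X(1)]
        source_functional_gaussian[OF assms(2)])
  moreover have "(LINT \<omega>|\<Omega>. Y \<omega> * Z \<omega>) = (LINT \<omega>|\<Omega>. (\<Sum>r\<in>sources_before N. X r \<omega> * Z \<omega>))"
    by (intro Bochner_Integration.integral_cong) (simp_all add: X(2) sum_distrib_right)
  ultimately have "(LINT \<omega>|\<Omega>. Y \<omega> * Z \<omega>) = (\<Sum>r\<in>sources_before N. LINT \<omega>|\<Omega>. X r \<omega> * Z \<omega>)"
    by simp
  also have "\<dots> = 0"
    using assms(3) by (intro sum.neutral ballI source_functionals_uncorrelated[OF X(1) assms(2)]) auto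
  finally show "(LINT \<omega>|\<Omega>. Y \<omega> * Z \<omega>) = 0" .
  then show "(LINT \<omega>|\<Omega>. Z \<omega> * Y \<omega>) = 0" by (simp add: mult.commute)
qed

lemma w_functional: "(\<lambda>\<omega>. a \<bullet> w k \<omega>) \<in> source_functionals (Disturbance k)"
  and v_functional: "(\<lambda>\<omega>. b \<bullet> v k \<omega>) \<in> source_functionals (Noise k)"
  by auto

lemma fresh_sources: "N \<le> k \<Longrightarrow> Disturbance k \<notin> sources_before N"
  "N \<le> k \<Longrightarrow> Noise k \<notin> sources_before N"
  "k < N \<Longrightarrow> Disturbance k \<in> sources_before N" "k < N \<Longrightarrow> Noise k \<in> sources_before N"
  by (auto simp: sources_before_def)

section \<open>Estimation errors, innovations and their moments\<close>

definition err :: "nat \<Rightarrow> 'a \<Rightarrow> real^'n" where "err k \<omega> = x k \<omega> - xhat k \<omega>"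

definition innov :: "nat \<Rightarrow> 'a \<Rightarrow> real^'p" where "innov k \<omega> = y k \<omega> - C k *v xhat k \<omega>"

text \<open>State and estimate receive the same input term, which cancels, so the error is linear in
  the sources for any feedback law. Matrices are moved onto \<open>d\<close> because the inductions
  vary the direction.\<close>

lemma err_Suc:
  assumes "k < T" "\<omega> \<in> space \<Omega>"
  shows "d \<bullet> err (Suc k) \<omega> = (transpose (A k) *v d - transpose (C k) *v (transpose (K k) *v d)) \<bullet> err k \<omega>
      + d \<bullet> w k \<omega> - (transpose (K k) *v d) \<bullet> v k \<omega>"
proof -
  have "err (Suc k) \<omega> = A k *v err k \<omega> - K k *v (C k *v err k \<omega>) + w k \<omega> - K k *v v k \<omega>"
    unfolding err_def using sys_x[OF assms] sys_y[OF assms] xhat_step[OF assms]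
    by (simp add: matrix_vector_mult_diff_distrib matrix_vector_right_distrib)
  then show ?thesis
    by (simp add: inner_add_right inner_diff_right inner_diff_left inner_matrix_vector)
qed

lemma innov_eq:
  assumes "k < T" "\<omega> \<in> space \<Omega>"
  shows "d \<bullet> innov k \<omega> = (transpose (C k) *v d) \<bullet> err k \<omega> + d \<bullet> v k \<omega>"
  unfolding innov_def err_def using sys_y[OF assms]
  by (simp add: inner_add_right inner_diff_right inner_matrix_vector)

lemma err_linear: "k \<le> T \<Longrightarrow> (\<lambda>\<omega>. d \<bullet> err k \<omega>) \<in> linear_functionals k"
proof (induction k arbitrary: d)
  case 0
  have "(\<lambda>\<omega>. d \<bullet> (x 0 \<omega> - xhat0)) \<in> linear_functionals 0"
    by (rule linear_functionals_source[of _ Initial]) (auto simp: sources_before_def)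
  then show ?case by (rule linear_functionals_cong) (simp add: err_def xhat_init)
next
  case (Suc k)
  then have k: "k < T" by simp
  show ?case
    by (rule linear_functionals_cong[OF _ err_Suc[OF k]])
      (intro linear_functionals_add linear_functionals_diff linear_functionals_mono[OF Suc.IH]
        linear_functionals_source[OF w_functional] linear_functionals_source[OF v_functional],
        use k in \<open>auto simp: fresh_sources\<close>)
qed

lemma innov_linear: "k < T \<Longrightarrow> (\<lambda>\<omega>. d \<bullet> innov k \<omega>) \<in> linear_functionals (Suc k)"
  by (rule linear_functionals_cong[OF _ innov_eq])
    (auto intro!: linear_functionals_add linear_functionals_mono[OF err_linear]
      linear_functionals_source[OF v_functional] simp: fresh_sources)

lemma w_moment: "(LINT \<omega>|\<Omega>. (a \<bullet> w k \<omega>) * (b \<bullet> w k \<omega>)) = a \<bullet> (Q k *v b)"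
  unfolding Q by (intro second_moment_inner centered_gaussianD source_functional_gaussian[OF w_functional]) simp

lemma v_moment: "(LINT \<omega>|\<Omega>. (a \<bullet> v k \<omega>) * (b \<bullet> v k \<omega>)) = a \<bullet> (R k *v b)"
  unfolding R by (intro second_moment_inner centered_gaussianD source_functional_gaussian[OF v_functional]) simp

text \<open>Cancelling the inverse in the gain gives the normal equation K S = A P C^T, with S the
  innovation covariance. Both the covariance recursion and the orthogonality of errors and
  innovations rest on it.\<close>

lemma gain_eq:
  assumes "k < T"
  shows "K k *v (C k *v (P k *v (transpose (C k) *v z))) + K k *v (R k *v z) = A k *v (P k *v (transpose (C k) *v z))"
proof -
  let ?S = "innovation_cov (C k) (R k) (P k)"
  have "K k ** ?S = A k ** P k ** transpose (C k)"
    using matrix_inv_mult[OF inv[OF assms]] unfolding K kalman_gain_def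
    by (metis matrix_mul_assoc matrix_mul_rid)
  then have "K k *v (?S *v z) = A k *v (P k *v (transpose (C k) *v z))"
    by (simp add: matrix_vector_mul_assoc matrix_mul_assoc)
  then show ?thesis
    by (simp add: innovation_cov_def matrix_vector_mult_add_rdistrib matrix_vector_right_distrib
        matrix_vector_mul_assoc matrix_mul_assoc)
qed

lemma P_Suc: "P (Suc k) *v z = A k *v (P k *v (transpose (A k) *v z)) + Q k *v z
    - K k *v (C k *v (P k *v (transpose (A k) *v z)))"
  unfolding P[of "Suc k"] error_cov.simps Let_def P[symmetric] K kalman_gain_def
  by (simp add: matrix_vector_mult_add_rdistrib matrix_vector_mult_diff_rdistrib
      matrix_vector_mul_assoc matrix_mul_assoc)

text \<open>Serves to reduce moments of the new error, against any test variable, to those of the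
  old error and the two fresh noises.\<close>

lemma err_Suc_mult:
  assumes k: "k < T" and Y: "centered_gaussian \<Omega> Y"
  shows "(LINT \<omega>|\<Omega>. (d \<bullet> err (Suc k) \<omega>) * Y \<omega>)
    = (LINT \<omega>|\<Omega>. ((transpose (A k) *v d - transpose (C k) *v (transpose (K k) *v d)) \<bullet> err k \<omega>) * Y \<omega>)
      + (LINT \<omega>|\<Omega>. (d \<bullet> w k \<omega>) * Y \<omega>) - (LINT \<omega>|\<Omega>. ((transpose (K k) *v d) \<bullet> v k \<omega>) * Y \<omega>)"
proof -
  let ?X = "\<lambda>\<omega>. (transpose (A k) *v d - transpose (C k) *v (transpose (K k) *v d)) \<bullet> err k \<omega>"
  have X: "?X \<in> linear_functionals (Suc k)"
    using k by (intro linear_functionals_mono[OF err_linear]) auto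
  have W: "(\<lambda>\<omega>. d \<bullet> w k \<omega>) \<in> linear_functionals (Suc k)"
    by (intro linear_functionals_source[OF w_functional] fresh_sources) simp
  have V: "(\<lambda>\<omega>. (transpose (K k) *v d) \<bullet> v k \<omega>) \<in> linear_functionals (Suc k)"
    by (intro linear_functionals_source[OF v_functional] fresh_sources) simp
  have "(LINT \<omega>|\<Omega>. (d \<bullet> err (Suc k) \<omega>) * Y \<omega>)
     = (LINT \<omega>|\<Omega>. (?X \<omega> + d \<bullet> w k \<omega> - (transpose (K k) *v d) \<bullet> v k \<omega>) * Y \<omega>)"
    by (intro Bochner_Integration.integral_cong) (simp_all add: err_Suc[OF k])
  then show ?thesis
    using centered_gaussian_mult_expand(2)[OF linear_functionals_gaussian[OF linear_functionals_add[OF X W]]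
        linear_functionals_gaussian[OF V] Y]
      centered_gaussian_mult_expand(1)[OF linear_functionals_gaussian[OF X]
        linear_functionals_gaussian[OF W] Y] by simp
qed

lemma innov_mult:
  assumes k: "k < T" and Y: "centered_gaussian \<Omega> Y"
  shows "(LINT \<omega>|\<Omega>. (d \<bullet> innov k \<omega>) * Y \<omega>)
    = (LINT \<omega>|\<Omega>. ((transpose (C k) *v d) \<bullet> err k \<omega>) * Y \<omega>) + (LINT \<omega>|\<Omega>. (d \<bullet> v k \<omega>) * Y \<omega>)"
proof -
  have "(LINT \<omega>|\<Omega>. (d \<bullet> innov k \<omega>) * Y \<omega>)
     = (LINT \<omega>|\<Omega>. ((transpose (C k) *v d) \<bullet> err k \<omega> + d \<bullet> v k \<omega>) * Y \<omega>)"
    by (intro Bochner_Integration.integral_cong) (simp_all add: innov_eq[OF k])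
  then show ?thesis
    using k centered_gaussian_mult_expand(1)[OF linear_functionals_gaussian[OF err_linear[of k]]
        source_functional_gaussian[OF v_functional] Y] by simp
qed

lemma err_uncorrelated:
  assumes "k \<le> T" "k \<le> i"
  shows "(LINT \<omega>|\<Omega>. (a \<bullet> w i \<omega>) * (b \<bullet> err k \<omega>)) = 0" "(LINT \<omega>|\<Omega>. (a' \<bullet> v i \<omega>) * (b \<bullet> err k \<omega>)) = 0"
    "(LINT \<omega>|\<Omega>. (b \<bullet> err k \<omega>) * (a \<bullet> w i \<omega>)) = 0" "(LINT \<omega>|\<Omega>. (b \<bullet> err k \<omega>) * (a' \<bullet> v i \<omega>)) = 0"
  using linear_functionals_uncorrelated[OF err_linear[OF assms(1)] w_functional fresh_sources(1)[OF assms(2)]]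
    linear_functionals_uncorrelated[OF err_linear[OF assms(1)] v_functional fresh_sources(2)[OF assms(2)]]
  by auto

lemma w_v_uncorrelated:
  "(LINT \<omega>|\<Omega>. (a \<bullet> w k \<omega>) * (b \<bullet> v i \<omega>)) = 0" "(LINT \<omega>|\<Omega>. (b \<bullet> v i \<omega>) * (a \<bullet> w k \<omega>)) = 0"
  using source_functionals_uncorrelated[OF w_functional v_functional]
    source_functionals_uncorrelated[OF v_functional w_functional] by simp_all

text \<open>Expanding the error step gives (A - K C) P (A - K C)^T + Q + K R K^T; cross terms vanish
  because disturbance and noise at \<open>k\<close> are fresh. The normal equation of the gain turns
  this into the Riccati form that defines \<open>P\<close>.\<close>

lemma err_moment: "k \<le> T \<Longrightarrow> (LINT \<omega>|\<Omega>. (a \<bullet> err k \<omega>) * (b \<bullet> err k \<omega>)) = a \<bullet> (P k *v b)"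
proof (induction k arbitrary: a b)
  case 0
  have "P 0 = second_moment \<Omega> (err 0)" unfolding P err_def[abs_def] by simp
  moreover have "err 0 \<in> borel_measurable \<Omega>"
    unfolding err_def[abs_def] using x_measurable[of 0] xhat_measurable[of 0] by simp
  ultimately show ?case
    by (simp only:) (intro second_moment_inner centered_gaussianD(2) linear_functionals_gaussian[OF err_linear], simp_all)
next
  case (Suc k)
  then have k: "k < T" "k \<le> T" by auto
  note gE = linear_functionals_gaussian[OF err_linear]
  note gW = source_functional_gaussian[OF w_functional]
  note gV = source_functional_gaussian[OF v_functional]
  let ?f = "\<lambda>a. transpose (A k) *v a - transpose (C k) *v (transpose (K k) *v a)"
  have "(LINT \<omega>|\<Omega>. (a \<bullet> err (Suc k) \<omega>) * (b \<bullet> err (Suc k) \<omega>)) =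
     ?f a \<bullet> (P k *v ?f b) + a \<bullet> (Q k *v b) + (transpose (K k) *v a) \<bullet> (R k *v (transpose (K k) *v b))"
  proof -
    have 1: "(LINT \<omega>|\<Omega>. (b \<bullet> err (Suc k) \<omega>) * (?f a \<bullet> err k \<omega>)) = ?f b \<bullet> (P k *v ?f a)"
      unfolding err_Suc_mult[OF k(1) gE[OF k(2)]] Suc.IH[OF k(2)] err_uncorrelated[OF k(2) order_refl]
      by simp
    have 2: "(LINT \<omega>|\<Omega>. (b \<bullet> err (Suc k) \<omega>) * (a \<bullet> w k \<omega>)) = b \<bullet> (Q k *v a)"
      unfolding err_Suc_mult[OF k(1) gW] w_moment w_v_uncorrelated err_uncorrelated[OF k(2) order_refl]
      by simp
    have 3: "(LINT \<omega>|\<Omega>. (b \<bullet> err (Suc k) \<omega>) * (c \<bullet> v k \<omega>)) = - ((transpose (K k) *v b) \<bullet> (R k *v c))" for c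
      unfolding err_Suc_mult[OF k(1) gV] v_moment w_v_uncorrelated err_uncorrelated[OF k(2) order_refl]
      by simp
    \<comment> \<open>The moments come out with the two directions exchanged; symmetry of the three
      forms follows from commuting the product under the integral.\<close>
    have s1: "a \<bullet> (P k *v b) = b \<bullet> (P k *v a)" for a b
      using Suc.IH[OF k(2), of a b] Suc.IH[OF k(2), of b a] by (simp add: mult.commute)
    have s2: "a \<bullet> (Q k *v b) = b \<bullet> (Q k *v a)" for a b
      using w_moment[of a k b] w_moment[of b k a] by (simp add: mult.commute)
    have s3: "a \<bullet> (R k *v b) = b \<bullet> (R k *v a)" for a b
      using v_moment[of a k b] v_moment[of b k a] by (simp add: mult.commute)
    show ?thesis
      unfolding err_Suc_mult[OF k(1) gE[OF Suc.prems]]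
      unfolding mult.commute[of _ "b \<bullet> _"] 1 2 3
      unfolding s1[of "?f a"] s2[of a] s3[of "transpose (K k) *v a"] by simp
  qed
  also have "\<dots> = a \<bullet> (P (Suc k) *v b)"
  proof -
    let ?p = "transpose (K k) *v b"
    have "?f a \<bullet> z = a \<bullet> (A k *v z - K k *v (C k *v z))" for z
      by (simp add: inner_diff_left inner_diff_right flip: inner_matrix_vector)
    then have "?f a \<bullet> (P k *v ?f b) + a \<bullet> (Q k *v b) + (transpose (K k) *v a) \<bullet> (R k *v ?p)
      = a \<bullet> (A k *v (P k *v ?f b) - K k *v (C k *v (P k *v ?f b)) + Q k *v b + K k *v (R k *v ?p))"
      by (simp add: inner_add_right flip: inner_matrix_vector)
    \<comment> \<open>The grouping makes the last bracket the left side of \<open>gain_eq\<close> at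
      \<open>?p\<close>, which cancels the subtracted term.\<close>
    also have "A k *v (P k *v ?f b) - K k *v (C k *v (P k *v ?f b)) + Q k *v b + K k *v (R k *v ?p)
      = P (Suc k) *v b - A k *v (P k *v (transpose (C k) *v ?p))
        + (K k *v (C k *v (P k *v (transpose (C k) *v ?p))) + K k *v (R k *v ?p))"
      unfolding P_Suc by (simp add: matrix_vector_mult_diff_distrib)
    finally show ?thesis unfolding gain_eq[OF k(1)] by simp
  qed
  finally show ?case .
qed

lemma source_innov_moment:
  assumes k: "k < T"
  shows "(LINT \<omega>|\<Omega>. (a \<bullet> err k \<omega>) * (b \<bullet> innov k \<omega>)) = a \<bullet> (P k *v (transpose (C k) *v b))"
    and "(LINT \<omega>|\<Omega>. (a \<bullet> w k \<omega>) * (b \<bullet> innov k \<omega>)) = 0"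
    and "(LINT \<omega>|\<Omega>. (c \<bullet> v k \<omega>) * (b \<bullet> innov k \<omega>)) = c \<bullet> (R k *v b)"
proof -
  have kT: "k \<le> T" using k by simp
  note gE = linear_functionals_gaussian[OF err_linear[OF kT]]
  note gW = source_functional_gaussian[OF w_functional]
  note gV = source_functional_gaussian[OF v_functional]
  note unc = err_uncorrelated[OF kT order_refl] w_v_uncorrelated
  have "(LINT \<omega>|\<Omega>. (b \<bullet> innov k \<omega>) * (a \<bullet> err k \<omega>)) = (LINT \<omega>|\<Omega>. (a \<bullet> err k \<omega>) * ((transpose (C k) *v b) \<bullet> err k \<omega>))"
    unfolding innov_mult[OF k gE] unc by (simp add: mult.commute)
  then show "(LINT \<omega>|\<Omega>. (a \<bullet> err k \<omega>) * (b \<bullet> innov k \<omega>)) = a \<bullet> (P k *v (transpose (C k) *v b))"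
    unfolding err_moment[OF kT] by (simp add: mult.commute)
  have "(LINT \<omega>|\<Omega>. (b \<bullet> innov k \<omega>) * (a \<bullet> w k \<omega>)) = 0"
    unfolding innov_mult[OF k gW] unc by simp
  then show "(LINT \<omega>|\<Omega>. (a \<bullet> w k \<omega>) * (b \<bullet> innov k \<omega>)) = 0" by (simp add: mult.commute)
  have "(LINT \<omega>|\<Omega>. (b \<bullet> innov k \<omega>) * (c \<bullet> v k \<omega>)) = (LINT \<omega>|\<Omega>. (c \<bullet> v k \<omega>) * (b \<bullet> v k \<omega>))"
    unfolding innov_mult[OF k gV] unc by (simp add: mult.commute)
  then show "(LINT \<omega>|\<Omega>. (c \<bullet> v k \<omega>) * (b \<bullet> innov k \<omega>)) = c \<bullet> (R k *v b)"
    unfolding v_moment by (simp add: mult.commute)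
qed

text \<open>Orthogonality to older innovations persists because the next error is built from the
  previous one and fresh noises. For the newest innovation the correlation is A P C^T - K (C P C^T +
  R), which the normal equation makes zero.\<close>

lemma err_innov_uncorrelated:
  assumes "k \<le> T" "j < k"
  shows "(LINT \<omega>|\<Omega>. (a \<bullet> err k \<omega>) * (b \<bullet> innov j \<omega>)) = 0"
  using assms
proof (induction k arbitrary: a)
  case 0
  then show ?case by simp
next
  case (Suc k)
  then have k: "k < T" "k \<le> T" "j < T" by auto
  note gR = linear_functionals_gaussian[OF innov_linear[OF k(3)]]
  show ?case
  proof (cases "j = k")
    case False
    then have jk: "j < k" using Suc.prems by simp
    have lr: "(\<lambda>\<omega>. b \<bullet> innov j \<omega>) \<in> linear_functionals k"
      using jk by (intro linear_functionals_mono[OF innov_linear[OF k(3)]]) simp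
    show ?thesis
      unfolding err_Suc_mult[OF k(1) gR] Suc.IH[OF k(2) jk]
        linear_functionals_uncorrelated(2)[OF lr w_functional fresh_sources(1)[OF order_refl]]
        linear_functionals_uncorrelated(2)[OF lr v_functional fresh_sources(2)[OF order_refl]] by simp
  next
    case True
    have "(LINT \<omega>|\<Omega>. (a \<bullet> err (Suc k) \<omega>) * (b \<bullet> innov k \<omega>))
       = a \<bullet> (A k *v (P k *v (transpose (C k) *v b)))
          - a \<bullet> (K k *v (C k *v (P k *v (transpose (C k) *v b))) + K k *v (R k *v b))"
      unfolding err_Suc_mult[OF k(1) linear_functionals_gaussian[OF innov_linear[OF k(1)]]] source_innov_moment[OF k(1)]
      by (simp add: inner_diff_left inner_add_right flip: inner_matrix_vector)
    then show ?thesis unfolding gain_eq[OF k(1)] by (simp add: True)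
  qed
qed

lemma innov_uncorrelated:
  assumes "k < T" "j < k"
  shows "(LINT \<omega>|\<Omega>. (a \<bullet> innov k \<omega>) * (b \<bullet> innov j \<omega>)) = 0"
proof -
  have j: "j < T" and kT: "k \<le> T" using assms by auto
  have lr: "(\<lambda>\<omega>. b \<bullet> innov j \<omega>) \<in> linear_functionals k"
    using assms by (intro linear_functionals_mono[OF innov_linear[OF j]]) simp
  show ?thesis
    unfolding innov_mult[OF assms(1) linear_functionals_gaussian[OF innov_linear[OF j]]]
      err_innov_uncorrelated[OF kT assms(2)]
      linear_functionals_uncorrelated(2)[OF lr v_functional fresh_sources(2)[OF order_refl]] by simp
qed

lemma innov_moment:
  assumes "k < T"
  shows "(LINT \<omega>|\<Omega>. (a \<bullet> innov k \<omega>) * (b \<bullet> innov k \<omega>))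
    = (transpose (C k) *v a) \<bullet> (P k *v (transpose (C k) *v b)) + a \<bullet> (R k *v b)"
  unfolding innov_mult[OF assms linear_functionals_gaussian[OF innov_linear[OF assms]]] source_innov_moment[OF assms] ..

lemma cov_v: "cov \<Omega> (v k) = R k"
  by (simp add: cov_def v_mean R)

section \<open>Independence of the innovation from the past\<close>

text \<open>The generators are preimages under the scalar components, a finite family of real
  variables, which is the form that \<open>uncorrelated_gaussian_independence\<close> takes.\<close>

definition innovation_sigma :: "nat \<Rightarrow> 'a measure" where
  "innovation_sigma k = sigma (space \<Omega>)
     (\<Union>p\<in>{..<k} \<times> UNIV. {(\<lambda>\<omega>. innov (fst p) \<omega> $ snd p) -` E \<inter> space \<Omega> | E. E \<in> sets borel})"

lemma space_innovation_sigma [simp]: "space (innovation_sigma k) = space \<Omega>"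
  by (simp add: innovation_sigma_def space_measure_of_conv)

lemma sets_innovation_sigma:
  "sets (innovation_sigma k) = sigma_sets (space \<Omega>)
     (\<Union>p\<in>{..<k} \<times> UNIV. {(\<lambda>\<omega>. innov (fst p) \<omega> $ snd p) -` E \<inter> space \<Omega> | E. E \<in> sets borel})"
  unfolding innovation_sigma_def by (rule sets_measure_of) auto

lemma innov_measurable:
  assumes "i < k"
  shows "innov i \<in> borel_measurable (innovation_sigma k)"
proof (rule borel_measurable_vecI)
  fix l
  show "(\<lambda>\<omega>. innov i \<omega> $ l) \<in> borel_measurable (innovation_sigma k)"
  proof (rule measurableI)
    fix E :: "real set" assume "E \<in> sets borel"
    then show "(\<lambda>\<omega>. innov i \<omega> $ l) -` E \<inter> space (innovation_sigma k) \<in> sets (innovation_sigma k)"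
      unfolding sets_innovation_sigma space_innovation_sigma using assms
      by (intro sigma_sets.Basic UN_I[of "(i, l)"]) auto
  qed simp
qed

text \<open>The input terms are determined by the past, so the innovations carry the same information
  as the measurements.\<close>

lemma sets_F_subset_innovation_sigma:
  "k \<le> T \<Longrightarrow> sets (F k) \<subseteq> sets (innovation_sigma k)"
proof (induction k rule: less_induct)
  case (less k)
  show ?case
  proof (rule sets_F_subset_of_measurable)
    fix i assume i: "i < k"
    have sub: "sets (innovation_sigma i) \<subseteq> sets (innovation_sigma k)"
      unfolding sets_innovation_sigma using i by (intro sigma_sets_subseteq UN_mono) auto
    \<comment> \<open>\<open>xhat i\<close> depends on the measurements before \<open>i\<close>
      only, so the induction hypothesis at \<open>i\<close> makes it measurable in earlier
      innovations.\<close>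
    have "subalgebra (innovation_sigma k) (F i)"
      using less.IH[OF i] less.prems i sub by (simp add: subalgebra_def)
    then have [measurable]: "xhat i \<in> borel_measurable (innovation_sigma k)"
      by (rule measurable_from_subalg[OF _ xhat_F_measurable]) (use less.prems i in simp)
    note [measurable] = innov_measurable[OF i]
    have "(\<lambda>\<omega>. innov i \<omega> + C i *v xhat i \<omega>) \<in> borel_measurable (innovation_sigma k)"
      by measurable
    then show "y i \<in> borel_measurable (innovation_sigma k)" by (simp add: innov_def)
  qed simp
qed

text \<open>Combinations of innovation components up to \<open>k\<close> are linear in the sources,
  hence Gaussian, and the newest innovation is uncorrelated with the earlier ones. Scalar
  projections suffice: the drift uses only the components of the correction and their
  squares.\<close>

lemma innovation_independent_past:
  assumes k: "k < T" and G: "G \<in> sets (F k)"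
    and f: "f \<in> borel_measurable borel" "integrable \<Omega> (\<lambda>\<omega>. f (d \<bullet> innov k \<omega>))"
  shows "(LINT \<omega>|\<Omega>. indicator G \<omega> * f (d \<bullet> innov k \<omega>)) = prob G * (LINT \<omega>|\<Omega>. f (d \<bullet> innov k \<omega>) :: real)"
proof (rule uncorrelated_gaussian_independence[where J = "{..<k} \<times> UNIV" and R = "\<lambda>p \<omega>. innov (fst p) \<omega> $ snd p"
      and Z = "\<lambda>\<omega>. d \<bullet> innov k \<omega>" and f = f])
  fix s :: real and t :: "nat \<times> 'p \<Rightarrow> real"
  have "(\<lambda>\<omega>. s * (d \<bullet> innov k \<omega>) + (\<Sum>p\<in>{..<k} \<times> UNIV. t p * (axis (snd p) 1 \<bullet> innov (fst p) \<omega>))) \<in> linear_functionals (Suc k)"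
    using k by (intro linear_functionals_add linear_functionals_scale linear_functionals_sum innov_linear
        linear_functionals_mono[OF innov_linear]) auto
  then show "centered_gaussian \<Omega> (\<lambda>\<omega>. s * (d \<bullet> innov k \<omega>) + (\<Sum>p\<in>{..<k} \<times> UNIV. t p * innov (fst p) \<omega> $ snd p))"
    using linear_functionals_gaussian by (simp add: inner_axis')
next
  fix p :: "nat \<times> 'p" assume "p \<in> {..<k} \<times> UNIV"
  then show "(LINT \<omega>|\<Omega>. (d \<bullet> innov k \<omega>) * innov (fst p) \<omega> $ snd p) = 0"
    using innov_uncorrelated[OF k, of "fst p" d "axis (snd p) 1"] by (auto simp: inner_axis')
next
  show "G \<in> sigma_sets (space \<Omega>) (\<Union>p\<in>{..<k} \<times> UNIV. {(\<lambda>\<omega>. innov (fst p) \<omega> $ snd p) -` E \<inter> space \<Omega> | E. E \<in> sets borel})"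
    using sets_F_subset_innovation_sigma[of k] G k unfolding sets_innovation_sigma by auto
qed (use f in auto)

lemma gain_innovation_component: "(K k *v innov k \<omega>) $ i = (transpose (K k) *v axis i 1) \<bullet> innov k \<omega>"
  by (simp add: inner_axis' flip: inner_matrix_vector)

lemma gain_innovation_gaussian:
  assumes "k < T" shows "centered_gaussian \<Omega> (\<lambda>\<omega>. (K k *v innov k \<omega>) $ i)"
  unfolding gain_innovation_component by (rule linear_functionals_gaussian[OF innov_linear[OF assms]])

text \<open>Mean squared norm of the filter correction \<open>K k *v innov k\<close>; times half the
  curvature bound it limits the expected one-step loss of \<open>h\<close>.\<close>

definition innovation_trace :: "nat \<Rightarrow> real" where
  "innovation_trace k = trace (K k ** cov \<Omega> (v k) ** transpose (K k))
     + trace (K k ** C k ** P k ** transpose (C k) ** transpose (K k))"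

text \<open>The squared norm is a sum of squared scalar projections of the innovation, each
  independent of \<open>G\<close>; their variances along the coordinate axes add up to the two
  traces.\<close>

lemma gain_innovation_norm:
  assumes k: "k < T" and G: "G \<in> sets (F k)"
  shows "integrable \<Omega> (\<lambda>\<omega>. (norm (K k *v innov k \<omega>))\<^sup>2)"
    and "(LINT \<omega>|\<Omega>. indicator G \<omega> * (norm (K k *v innov k \<omega>))\<^sup>2) = innovation_trace k * prob G"
proof -
  let ?q = "\<lambda>i. transpose (K k) *v axis i 1"
  have n: "(norm (K k *v innov k \<omega>))\<^sup>2 = (\<Sum>i\<in>UNIV. (?q i \<bullet> innov k \<omega>)\<^sup>2)" for \<omega>
    unfolding power2_norm_eq_inner inner_vec_def[of "K k *v innov k \<omega>"] gain_innovation_component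
    by (simp add: power2_eq_square)
  have i2: "integrable \<Omega> (\<lambda>\<omega>. (q \<bullet> innov k \<omega>)\<^sup>2)" for q
    using centered_gaussianD(2)[OF linear_functionals_gaussian[OF innov_linear[OF k]]] .
  show "integrable \<Omega> (\<lambda>\<omega>. (norm (K k *v innov k \<omega>))\<^sup>2)" unfolding n using i2 by simp
  have GM [measurable]: "G \<in> sets \<Omega>" using G subalgebra_F[of k] k by (auto simp: subalgebra_def)
  have iG: "integrable \<Omega> (\<lambda>\<omega>. indicator G \<omega> * (q \<bullet> innov k \<omega>)\<^sup>2)" for q
    using borel_measurable_integrable[OF i2]
    by (auto intro!: Bochner_Integration.integrable_bound[OF i2] simp: indicator_def)
  have "(LINT \<omega>|\<Omega>. indicator G \<omega> * (norm (K k *v innov k \<omega>))\<^sup>2)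
      = (\<Sum>i\<in>UNIV. LINT \<omega>|\<Omega>. indicator G \<omega> * (?q i \<bullet> innov k \<omega>)\<^sup>2)"
    unfolding n sum_distrib_left by (rule Bochner_Integration.integral_sum) (rule iG)
  also have "\<dots> = (\<Sum>i\<in>UNIV. prob G * (LINT \<omega>|\<Omega>. (?q i \<bullet> innov k \<omega>)\<^sup>2))"
    using i2 by (intro sum.cong refl innovation_independent_past[OF k G]) auto
  also have "\<dots> = (\<Sum>i\<in>UNIV. prob G * ((transpose (C k) *v ?q i) \<bullet> (P k *v (transpose (C k) *v ?q i)) + ?q i \<bullet> (R k *v ?q i)))"
    using innov_moment[OF k] by (simp add: power2_eq_square)
  also have "\<dots> = innovation_trace k * prob G"
    unfolding innovation_trace_def trace_eq_sum_axis cov_v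
    by (simp add: sum_distrib_left sum_distrib_right distrib_left distrib_right sum.distrib mult_ac
        matrix_vector_mul_assoc[symmetric] flip: inner_matrix_vector)
  finally show "(LINT \<omega>|\<Omega>. indicator G \<omega> * (norm (K k *v innov k \<omega>))\<^sup>2) = innovation_trace k * prob G" .
qed

text \<open>Each component of the correction has conditional mean zero given \<open>F k\<close>, and
  the bound on \<open>g\<close> keeps the products integrable.\<close>

lemma gain_innovation_orthogonal_past:
  assumes k: "k < T" and g: "g \<in> borel_measurable (F k)" and b: "\<And>\<omega>. norm (g \<omega>) \<le> b"
  shows "integrable \<Omega> (\<lambda>\<omega>. g \<omega> \<bullet> (K k *v innov k \<omega>))" "(LINT \<omega>|\<Omega>. g \<omega> \<bullet> (K k *v innov k \<omega>)) = 0"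
proof -
  interpret Fk: finite_measure_subalgebra \<Omega> "F k"
    by unfold_locales (rule subalgebra_F, use k in simp)
  have gm [measurable]: "g \<in> borel_measurable \<Omega>" by (rule F_measurable[OF less_imp_le[OF k] g])
  have comp: "integrable \<Omega> (\<lambda>\<omega>. g \<omega> $ i * (K k *v innov k \<omega>) $ i) \<and> (LINT \<omega>|\<Omega>. g \<omega> $ i * (K k *v innov k \<omega>) $ i) = 0" for i
  proof
    let ?Z = "\<lambda>\<omega>. (K k *v innov k \<omega>) $ i"
    note cg = gain_innovation_gaussian[OF k, of i]
    note iZ = centered_gaussian_integrable[OF cg]
    note [measurable] = centered_gaussianD(1)[OF cg]
    have gi: "(\<lambda>\<omega>. g \<omega> $ i) \<in> borel_measurable (F k)" using measurable_compose[OF g borel_measurable_nth] .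
    have [measurable]: "(\<lambda>\<omega>. g \<omega> $ i) \<in> borel_measurable \<Omega>" using measurable_compose[OF gm borel_measurable_nth] .
    show int: "integrable \<Omega> (\<lambda>\<omega>. g \<omega> $ i * ?Z \<omega>)"
    proof (rule Bochner_Integration.integrable_bound)
      show "integrable \<Omega> (\<lambda>\<omega>. b * ?Z \<omega>)" using iZ by simp
      have "\<bar>g \<omega> $ i\<bar> \<le> \<bar>b\<bar>" for \<omega> using component_le_norm_cart[of "g \<omega>" i] b[of \<omega>] by linarith
      then show "AE \<omega> in \<Omega>. norm (g \<omega> $ i * ?Z \<omega>) \<le> norm (b * ?Z \<omega>)"
        by (simp add: abs_mult mult_right_mono)
    qed simp
    have "AE \<omega> in \<Omega>. real_cond_exp \<Omega> (F k) ?Z \<omega> = 0"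
    proof (rule Fk.real_cond_exp_charact)
      fix G assume G: "G \<in> sets (F k)"
      show "(LINT \<omega>:G|\<Omega>. ?Z \<omega>) = (LINT \<omega>:G|\<Omega>. 0)"
        using innovation_independent_past[OF k G, of "\<lambda>z. z" "transpose (K k) *v axis i 1"] iZ
          centered_gaussianD(3)[OF cg]
        by (simp add: set_lebesgue_integral_def gain_innovation_component)
    qed (use iZ in auto)
    then have "(LINT \<omega>|\<Omega>. g \<omega> $ i * real_cond_exp \<Omega> (F k) ?Z \<omega>) = (LINT \<omega>|\<Omega>. 0)"
      by (intro integral_cong_AE) auto
    then show "(LINT \<omega>|\<Omega>. g \<omega> $ i * ?Z \<omega>) = 0"
      using Fk.real_cond_exp_intg(2)[OF int gi] by simp
  qed
  then show "integrable \<Omega> (\<lambda>\<omega>. g \<omega> \<bullet> (K k *v innov k \<omega>))" "(LINT \<omega>|\<Omega>. g \<omega> \<bullet> (K k *v innov k \<omega>)) = 0"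
    by (simp_all add: inner_vec_def)
qed

section \<open>One-step drift of the barrier along the estimates\<close>

definition pred :: "nat \<Rightarrow> 'a \<Rightarrow> real^'n" where "pred k \<omega> = A k *v xhat k \<omega> + B k *v u k \<omega>"

lemma pred_F_measurable: "k < T \<Longrightarrow> pred k \<in> borel_measurable (F k)"
  using xhat_F_measurable[of k] u_meas[of k] unfolding pred_def[abs_def] by simp

lemma xhat_Suc: "k < T \<Longrightarrow> \<omega> \<in> space \<Omega> \<Longrightarrow> xhat (Suc k) \<omega> = pred k \<omega> + K k *v innov k \<omega>"
  by (simp add: xhat_step pred_def innov_def)

text \<open>On \<open>G\<close> the gradient at \<open>pred k\<close> is bounded because \<open>h\<close> has a lower bound there; this makes the
  first-order term of the Taylor bound integrable, although the input itself need not be.\<close>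

lemma expected_value_drift:
  assumes k: "k < T" and h: "twice_continuously_differentiable h" and L: "L > 0"
    and hess: "\<And>q. spectral_norm (hessian h q) \<le> L" and M: "\<And>q. h q \<le> M"
    and G: "G \<in> sets (F k)" and low: "AE \<omega> in \<Omega>. \<omega> \<in> G \<longrightarrow> b \<le> h (pred k \<omega>)"
  shows "integrable \<Omega> (\<lambda>\<omega>. indicator G \<omega> * (M - h (pred k \<omega>)))"
    and "integrable \<Omega> (\<lambda>\<omega>. indicator G \<omega> * (M - h (xhat (Suc k) \<omega>)))"
    and "(LINT \<omega>|\<Omega>. indicator G \<omega> * (M - h (xhat (Suc k) \<omega>)))
       \<le> (LINT \<omega>|\<Omega>. indicator G \<omega> * (M - h (pred k \<omega>))) + L / 2 * innovation_trace k * prob G"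
proof -
  note [measurable] = twice_continuously_differentiable_measurable[OF h]
  note zF [measurable] = pred_F_measurable[OF k]
  have zM [measurable]: "pred k \<in> borel_measurable \<Omega>" by (rule F_measurable[OF less_imp_le[OF k] zF])
  have xM [measurable]: "xhat (Suc k) \<in> borel_measurable \<Omega>" using xhat_measurable k by simp
  \<comment> \<open>The floor \<open>b\<close> holds only almost surely on \<open>G\<close>.
    \<open>G'\<close> enforces it everywhere, remains in \<open>F k\<close>, and differs from
    \<open>G\<close> by a null set.\<close>
  define G' where "G' = {\<omega> \<in> space (F k). \<omega> \<in> G \<and> b \<le> h (pred k \<omega>)}"
  have G'F [measurable]: "G' \<in> sets (F k)" unfolding G'_def using G by measurable
  have sub: "sets (F k) \<subseteq> sets \<Omega>" using subalgebra_F[of k] k by (simp add: subalgebra_def)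
  have GM [measurable]: "G \<in> sets \<Omega>" "G' \<in> sets \<Omega>" using G G'F sub by auto
  have Geq: "AE \<omega> in \<Omega>. indicator G \<omega> = (indicat_real G' \<omega>)"
    using low AE_space by eventually_elim (auto simp: G'_def indicator_def)
  have pG: "prob G = prob G'"
    using low GM by (intro finite_measure_eq_AE) (auto simp: G'_def)
  let ?N = "\<lambda>\<omega>. K k *v innov k \<omega>"
  define g where "g \<omega> = indicator G' \<omega> *\<^sub>R gradient h (pred k \<omega>)" for \<omega>
  have gF: "g \<in> borel_measurable (F k)" unfolding g_def[abs_def] by measurable
  have gb: "norm (g \<omega>) \<le> sqrt (2 * L * \<bar>M - b\<bar>)" for \<omega>
  proof (cases "\<omega> \<in> G'")
    case True
    then have "b \<le> h (pred k \<omega>)" by (simp add: G'_def)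
    then have "2 * L * (M - h (pred k \<omega>)) \<le> 2 * L * \<bar>M - b\<bar>" using L by simp
    then have "(norm (gradient h (pred k \<omega>)))\<^sup>2 \<le> 2 * L * \<bar>M - b\<bar>"
      using gradient_bound_of_upper_bound[OF h L hess M, of "pred k \<omega>"] by linarith
    then show ?thesis using True by (simp add: g_def real_le_rsqrt)
  qed (use L in \<open>simp add: g_def\<close>)
  note go = gain_innovation_orthogonal_past[OF k gF gb]
  note nn = gain_innovation_norm[OF k G'F]
  have iz': "integrable \<Omega> (\<lambda>\<omega>. indicator G' \<omega> * (M - h (pred k \<omega>)))"
    using M by (intro integrable_const_bound[where B = "\<bar>M - b\<bar>"]) (auto simp: G'_def indicator_def)
  have iN: "integrable \<Omega> (\<lambda>\<omega>. indicator G' \<omega> * (norm (?N \<omega>))\<^sup>2)"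
    using borel_measurable_integrable[OF nn(1)]
    by (auto intro!: Bochner_Integration.integrable_bound[OF nn(1)] simp: indicator_def)
  \<comment> \<open>The Taylor bound at the predicted state, with correction \<open>?N\<close>,
    makes \<open>U\<close> a majorant of the next value on \<open>G'\<close>. Its middle term has
    mean zero and its last one gives the trace.\<close>
  define U where "U \<omega> = indicator G' \<omega> * (M - h (pred k \<omega>)) - g \<omega> \<bullet> ?N \<omega>
      + L / 2 * (indicator G' \<omega> * (norm (?N \<omega>))\<^sup>2)" for \<omega>
  have iU: "integrable \<Omega> U" unfolding U_def[abs_def]
    by (intro Bochner_Integration.integrable_add Bochner_Integration.integrable_diff integrable_mult_right iz' iN go(1))
  have IU: "(LINT \<omega>|\<Omega>. U \<omega>) = (LINT \<omega>|\<Omega>. indicator G' \<omega> * (M - h (pred k \<omega>))) + L / 2 * innovation_trace k * prob G"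
    unfolding U_def using iz' go iN nn(2) pG by simp
  have le: "indicator G' \<omega> * (M - h (xhat (Suc k) \<omega>)) \<le> U \<omega>" if "\<omega> \<in> space \<Omega>" for \<omega>
    using hessian_bound_taylor_lower[OF h hess, of "pred k \<omega>" "?N \<omega>"]
    by (simp add: U_def g_def xhat_Suc[OF k that] indicator_def)
  have ix': "integrable \<Omega> (\<lambda>\<omega>. indicator G' \<omega> * (M - h (xhat (Suc k) \<omega>)))"
  proof (rule Bochner_Integration.integrable_bound[OF iU])
    show "AE \<omega> in \<Omega>. norm (indicator G' \<omega> * (M - h (xhat (Suc k) \<omega>))) \<le> norm (U \<omega>)"
      using AE_space
    proof eventually_elim
      case (elim \<omega>)
      \<comment> \<open>Nonnegativity turns the one-sided estimate \<open>le\<close> into a bound in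
        absolute value.\<close>
      have "0 \<le> indicator G' \<omega> * (M - h (xhat (Suc k) \<omega>))" using M by simp
      then show ?case using le[OF elim] by simp
    qed
  qed measurable
  have swap: "integrable \<Omega> (\<lambda>\<omega>. indicator G \<omega> * q \<omega>) \<longleftrightarrow> integrable \<Omega> (\<lambda>\<omega>. indicator G' \<omega> * q \<omega>)"
    "(LINT \<omega>|\<Omega>. indicator G \<omega> * q \<omega>) = (LINT \<omega>|\<Omega>. indicator G' \<omega> * q \<omega>)"
    if [measurable]: "q \<in> borel_measurable \<Omega>" for q :: "'a \<Rightarrow> real"
    using Geq by (intro integrable_cong_AE integral_cong_AE; simp; eventually_elim; simp)+
  show "integrable \<Omega> (\<lambda>\<omega>. indicator G \<omega> * (M - h (pred k \<omega>)))" using iz' by (subst swap) simp_all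
  show "integrable \<Omega> (\<lambda>\<omega>. indicator G \<omega> * (M - h (xhat (Suc k) \<omega>)))" using ix' by (subst swap) simp_all
  have "(LINT \<omega>|\<Omega>. indicator G' \<omega> * (M - h (xhat (Suc k) \<omega>))) \<le> (LINT \<omega>|\<Omega>. U \<omega>)"
    using le by (intro integral_mono ix' iU) auto
  then show "(LINT \<omega>|\<Omega>. indicator G \<omega> * (M - h (xhat (Suc k) \<omega>)))
       \<le> (LINT \<omega>|\<Omega>. indicator G \<omega> * (M - h (pred k \<omega>))) + L / 2 * innovation_trace k * prob G"
    by (subst (1 2) swap) (simp_all add: IU)
qed

end

subsection \<open>Safety under the filtered barrier condition\<close>

text \<open>Zeros of \<open>h\<close> themselves enter the supremum, so the margin is nonnegative
  and the intermediate value theorem finds a zero between \<open>b\<close> and \<open>a\<close>. Its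
  distance from \<open>a\<close> is less than \<open>\<gamma>\<close>, hence the margin also bounds
  \<open>h a\<close> from above.\<close>

lemma zero_near_margin_crossing:
  fixes h :: "real^'n \<Rightarrow> real"
  assumes cont: "continuous_on UNIV h" and M: "\<And>q. h q \<le> M" and \<gamma>: "0 < \<gamma>"
    and zero: "h -` {0} \<noteq> {}" and near: "norm (b - a) \<le> \<gamma>"
    and a: "h_margin h \<gamma> \<le> h a" and b: "h b < 0"
  obtains q where "h q = 0" "norm (a - q) < \<gamma>" "h a = h_margin h \<gamma>"
proof -
  let ?S = "{h x | x. \<exists>x0 \<in> h -` {0}. norm (x - x0) \<le> \<gamma>}"
  have bdd: "bdd_above ?S" using M by (auto intro!: bdd_aboveI[of _ M])
  have upper: "h c \<le> h_margin h \<gamma>" if "h q = 0" "norm (c - q) \<le> \<gamma>" for c q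
    unfolding h_margin_def using that by (intro cSup_upper[OF _ bdd]) auto
  obtain q0 where "h q0 = 0" using zero by auto
  with upper[of q0 q0] \<gamma> have "0 \<le> h_margin h \<gamma>" by simp
  define \<phi> where "\<phi> t = h (b + t *\<^sub>R (a - b))" for t
  have "continuous_on {0..1} \<phi>" unfolding \<phi>_def
    by (intro continuous_on_compose2[OF cont] continuous_intros) auto
  moreover have "\<phi> 0 \<le> 0" "0 \<le> \<phi> 1" using a b \<open>0 \<le> h_margin h \<gamma>\<close> by (auto simp: \<phi>_def)
  ultimately obtain t where t: "0 \<le> t" "t \<le> 1" "\<phi> t = 0"
    using IVT'[of \<phi> 0 0 1] by auto
  \<comment> \<open>Strict negativity at \<open>b\<close> keeps the zero away from \<open>b\<close>;
    this makes the distance bound strict.\<close>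
  have "t \<noteq> 0" using t(3) b by (auto simp: \<phi>_def)
  define q where "q = b + t *\<^sub>R (a - b)"
  have "a - q = (1 - t) *\<^sub>R (a - b)" by (simp add: q_def algebra_simps)
  then have "norm (a - q) = (1 - t) * norm (b - a)" using t by (simp add: norm_minus_commute)
  also have "\<dots> \<le> (1 - t) * \<gamma>" using t near by (intro mult_left_mono) auto
  also have "\<dots> < 1 * \<gamma>" using t \<open>t \<noteq> 0\<close> \<gamma> by (intro mult_strict_right_mono) auto
  finally have lt: "norm (a - q) < \<gamma>" by simp
  have "h q = 0" using t by (simp add: \<phi>_def q_def)
  with upper[of q a] lt a have "h a = h_margin h \<gamma>" by simp
  with \<open>h q = 0\<close> lt show ?thesis by (rule that)
qed

theorem theorem1:
  fixes \<Omega> :: "'a measure"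
    and A :: "nat \<Rightarrow> real^'n^'n" and B :: "nat \<Rightarrow> real^'m^'n" and C :: "nat \<Rightarrow> real^'n^'p"
    and x xhat w :: "nat \<Rightarrow> 'a \<Rightarrow> real^'n"
    and y v :: "nat \<Rightarrow> 'a \<Rightarrow> real^'p"
    and u uhat :: "nat \<Rightarrow> 'a \<Rightarrow> real^'m"
    and Q P :: "nat \<Rightarrow> real^'n^'n" and R :: "nat \<Rightarrow> real^'p^'p" and K :: "nat \<Rightarrow> real^'p^'n"
    and xhat0 :: "real^'n"
    and h hhat :: "real^'n \<Rightarrow> real"
    and T :: nat
    and \<sigma> \<gamma> h_marg M lmax \<alpha> cJ \<delta> :: real
  assumes prob: "prob_space \<Omega>"
    and x0_gauss: "gaussian_vector \<Omega> (x 0)"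
    and w_gauss: "\<And>k. gaussian_vector \<Omega> (w k)"
    and v_gauss: "\<And>k. gaussian_vector \<Omega> (v k)"
    and w_mean: "\<And>k. (LINT \<omega>|\<Omega>. w k \<omega>) = 0"
    and v_mean: "\<And>k. (LINT \<omega>|\<Omega>. v k \<omega>) = 0"
    and w_sq: "\<And>k. integrable \<Omega> (\<lambda>\<omega>. (norm (w k \<omega>))\<^sup>2)"
    and v_sq: "\<And>k. integrable \<Omega> (\<lambda>\<omega>. (norm (v k \<omega>))\<^sup>2)"
    and indep: "prob_space.indep_sets \<Omega> (source_events \<Omega> (x 0) w v) UNIV"
    and sys_x: "\<And>k \<omega>. k < T \<Longrightarrow> \<omega> \<in> space \<Omega> \<Longrightarrow> x (Suc k) \<omega> = A k *v x k \<omega> + B k *v u k \<omega> + w k \<omega>"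
    and sys_y: "\<And>k \<omega>. k < T \<Longrightarrow> \<omega> \<in> space \<Omega> \<Longrightarrow> y k \<omega> = C k *v x k \<omega> + v k \<omega>"
    and Q: "\<And>k. Q k = second_moment \<Omega> (w k)"
    and R: "\<And>k. R k = second_moment \<Omega> (v k)"
    and P: "\<And>k. P k = error_cov A C Q R (second_moment \<Omega> (\<lambda>\<omega>. x 0 \<omega> - xhat 0 \<omega>)) k"
    and inv: "\<And>k. k < T \<Longrightarrow> invertible (innovation_cov (C k) (R k) (P k))"
    and K: "\<And>k. K k = kalman_gain (A k) (C k) (R k) (P k)"
    and xhat_init: "\<And>\<omega>. \<omega> \<in> space \<Omega> \<Longrightarrow> xhat 0 \<omega> = xhat0"
    and xhat_step: "\<And>k \<omega>. k < T \<Longrightarrow> \<omega> \<in> space \<Omega> \<Longrightarrow>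
           xhat (Suc k) \<omega> = A k *v xhat k \<omega> + B k *v u k \<omega> + K k *v (y k \<omega> - C k *v xhat k \<omega>)"
    and xhat_ce: "\<And>k. k \<le> T \<Longrightarrow> is_cond_exp \<Omega> (past_measurements \<Omega> y k) (x k) (xhat k)"
    and h_C2: "twice_continuously_differentiable h"
    and lmax_pos: "lmax > 0"
    and h_hess: "\<And>z. spectral_norm (hessian h z) \<le> lmax"
    and M_pos: "M > 0"
    and h_le_M: "\<And>z. h z \<le> M"
    and sigma: "\<sigma> > 0"
    and gamma: "\<gamma> > 0"
    and sigma_gamma: "measure \<Omega> {\<omega> \<in> space \<Omega>. (SUP k\<in>{0..T}. norm (x k \<omega> - xhat k \<omega>)) \<le> \<gamma>} \<ge> 1 - \<sigma>"
    and h_marg: "h_marg = h_margin h \<gamma>"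
    and h_zero: "h -` {0} \<noteq> {}"
    and h_marg_M: "h_marg < M"
    and hhat: "hhat = (\<lambda>z. h z - h_marg)"
    and hhat_nondeg: "AE \<omega> in \<Omega>. \<forall>k\<le>T. \<forall>z0. h z0 = 0 \<longrightarrow> norm (xhat k \<omega> - z0) < \<gamma> \<longrightarrow> hhat (xhat k \<omega>) \<noteq> 0"
    and alpha0: "0 < \<alpha>"
    and alpha1: "\<alpha> < 1"
    and cJ_nonneg: "0 \<le> cJ"
    and cJ_le: "\<And>k. k < T \<Longrightarrow>
           cJ \<le> (M - h_marg) * (1 - \<alpha>)
               + lmax / 2 * trace (K k ** cov \<Omega> (v k) ** transpose (K k))
               + lmax / 2 * trace (K k ** C k ** P k ** transpose (C k) ** transpose (K k))"
    and uhat_meas: "\<And>k. k < T \<Longrightarrow> uhat k \<in> borel_measurable (past_measurements \<Omega> y k)"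
    and u_meas: "\<And>k. k < T \<Longrightarrow> u k \<in> borel_measurable (past_measurements \<Omega> y k)"
    and u_opt: "AE \<omega> in \<Omega>. is_arg_min (\<lambda>c. \<Sum>k<T. (norm (c k - uhat k \<omega>))\<^sup>2)
           (\<lambda>c. \<forall>k<T. hhat (A k *v xhat k \<omega> + B k *v c k) - cJ \<ge> \<alpha> * hhat (xhat k \<omega>))
           (\<lambda>k. u k \<omega>)"
    and delta: "\<And>k. k < T \<Longrightarrow>
           \<delta> \<le> cJ - lmax / 2 * trace (K k ** cov \<Omega> (v k) ** transpose (K k))
                  - lmax / 2 * trace (K k ** C k ** P k ** transpose (C k) ** transpose (K k))"
  shows "safety_prob \<Omega> h T x \<ge> 1 - exit_prob \<Omega> hhat T xhat - \<sigma>
    \<and> (\<delta> < 0 \<longrightarrow>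
         exit_prob \<Omega> hhat T xhat
           \<le> ((M - h_marg - hhat xhat0) / (M - h_marg)) * \<alpha> ^ T
             + ((M - h_marg) * (1 - \<alpha>) - \<delta>) / (M - h_marg) * (\<Sum>i=1..T. \<alpha> ^ (i - 1)))
    \<and> (\<delta> \<ge> 0 \<longrightarrow>
         exit_prob \<Omega> hhat T xhat
           \<le> 1 - hhat xhat0 / (M - h_marg) * (((M - h_marg) * \<alpha> + \<delta>) / (M - h_marg)) ^ T)"
proof -
  interpret kf: kalman_filter \<Omega> A B C x xhat w y v u Q P R K xhat0 T
    by (intro kalman_filter.intro kalman_filter_axioms.intro) fact+
  define m where "m = M - h_marg"
  have m: "m > 0" using h_marg_M by (simp add: m_def)
  \<comment> \<open>The scaling puts the exit level at one: \<open>1 - V k \<omega>\<close> is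
    \<open>hhat (xhat k \<omega>) / m\<close>, and the ceiling \<open>M\<close> makes
    \<open>V\<close> nonnegative.\<close>
  define V where "V k \<omega> = (M - h (xhat k \<omega>)) / m" for k \<omega>
  define S where "S = (\<lambda>k. {\<omega> \<in> space \<Omega>. \<forall>i\<le>k. V i \<omega> \<le> 1})"
  define \<beta> where "\<beta> = 1 - \<alpha> - \<delta> / m"
  define v0 where "v0 = (M - h xhat0) / m"
  note [measurable] = twice_continuously_differentiable_measurable[OF h_C2]
  have VF: "V i \<in> borel_measurable (kf.F k)" if "i \<le> k" "k \<le> T" for i k
  proof -
    have [measurable]: "xhat i \<in> borel_measurable (kf.F k)"
      by (rule measurable_from_subalg[OF kf.subalgebra_F_mono[OF that(1)] kf.xhat_F_measurable])
        (use that in simp)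
    show ?thesis unfolding V_def[abs_def] by measurable
  qed
  have Vm: "V k \<in> borel_measurable \<Omega>" if "k \<le> T" for k
    by (rule kf.F_measurable[OF that VF[OF order_refl that]])
  have Vnn: "0 \<le> V k \<omega>" for k \<omega> using h_le_M m by (simp add: V_def)
  have hV: "hhat (xhat k \<omega>) = m * (1 - V k \<omega>)" for k \<omega>
    using m by (simp add: hhat V_def m_def field_simps)
  have hhat_neg: "hhat (xhat k \<omega>) < 0 \<longleftrightarrow> \<not> V k \<omega> \<le> 1" for k \<omega>
    unfolding hV using m by (auto simp: mult_less_0_iff)
  have SF: "S k \<in> sets (kf.F k)" if "k \<le> T" for k
  proof -
    have [measurable]: "V i \<in> borel_measurable (kf.F k)" if "i \<in> {..k}" for i
      using VF \<open>k \<le> T\<close> that by simp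
    have "S k = {\<omega> \<in> space (kf.F k). \<forall>i\<in>{..k}. V i \<omega> \<le> 1}" by (auto simp: S_def)
    also have "\<dots> \<in> sets (kf.F k)" by measurable
    finally show ?thesis .
  qed
  have SM: "S k \<in> sets \<Omega>" if "k \<le> T" for k
    using SF[OF that] kf.subalgebra_F[OF that] by (auto simp: subalgebra_def)
  have constraint: "AE \<omega> in \<Omega>. \<forall>k<T. \<alpha> * hhat (xhat k \<omega>) \<le> hhat (kf.pred k \<omega>) - cJ"
    using u_opt by eventually_elim (auto simp: is_arg_min_def kf.pred_def)
  have drift: "integrable \<Omega> (\<lambda>\<omega>. indicator (S k) \<omega> * V (Suc k) \<omega>)"
    "(LINT \<omega>|\<Omega>. indicator (S k) \<omega> * V (Suc k) \<omega>) \<le> (LINT \<omega>|\<Omega>. indicator (S k) \<omega> * (\<alpha> * V k \<omega> + \<beta>))"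
    if k: "k < T" for k
  proof -
    have kT: "k \<le> T" using k by simp
    note [measurable] = SM[OF kT] Vm[OF kT]
    \<comment> \<open>Survival gives \<open>hhat (xhat k \<omega>) \<ge> 0\<close>, so with
      \<open>cJ \<ge> 0\<close> the constraint keeps the predicted state in the superlevel set. This
      is the floor that the drift lemma requires.\<close>
    have low: "AE \<omega> in \<Omega>. \<omega> \<in> S k \<longrightarrow> h_marg \<le> h (kf.pred k \<omega>)"
      using constraint
    proof eventually_elim
      case (elim \<omega>)
      show ?case
      proof
        assume "\<omega> \<in> S k"
        then have "0 \<le> hhat (xhat k \<omega>)" using hhat_neg[of k \<omega>] by (simp add: S_def not_less)
        then have "0 \<le> \<alpha> * hhat (xhat k \<omega>)" using alpha0 by simp
        then have "0 \<le> hhat (kf.pred k \<omega>)" using elim k cJ_nonneg by fastforce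
        then show "h_marg \<le> h (kf.pred k \<omega>)" by (simp add: hhat)
      qed
    qed
    note D = kf.expected_value_drift[OF k h_C2 lmax_pos h_hess h_le_M SF[OF kT] low]
    have iV: "integrable \<Omega> (\<lambda>\<omega>. indicator (S k) \<omega> * (m * (\<alpha> * V k \<omega> + (1 - \<alpha>)) - cJ))"
    proof (rule kf.integrable_const_bound[where B = "m + \<bar>cJ\<bar>"])
      have "\<bar>m * (\<alpha> * V k \<omega> + (1 - \<alpha>)) - cJ\<bar> \<le> m + \<bar>cJ\<bar>" if "\<omega> \<in> S k" for \<omega>
      proof -
        have "\<alpha> * V k \<omega> \<le> \<alpha>" using that alpha0 by (simp add: S_def)
        moreover have "0 \<le> \<alpha> * V k \<omega>" using Vnn alpha0 by simp
        ultimately have "m * (\<alpha> * V k \<omega> + (1 - \<alpha>)) \<le> m * 1" "0 \<le> m * (\<alpha> * V k \<omega> + (1 - \<alpha>))"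
          using m alpha1 by (intro mult_left_mono mult_nonneg_nonneg; simp)+
        then show ?thesis by linarith
      qed
      then show "AE \<omega> in \<Omega>. norm (indicator (S k) \<omega> * (m * (\<alpha> * V k \<omega> + (1 - \<alpha>)) - cJ)) \<le> m + \<bar>cJ\<bar>"
        using m by (auto simp: indicator_def)
    qed measurable
    have iI: "integrable \<Omega> (indicat_real (S k))"
      by (rule kf.integrable_const_bound[where B = 1]) auto
    have eqV: "indicator (S k) \<omega> * V (Suc k) \<omega> = indicator (S k) \<omega> * (M - h (xhat (Suc k) \<omega>)) / m" for \<omega>
      by (simp add: V_def)
    show "integrable \<Omega> (\<lambda>\<omega>. indicator (S k) \<omega> * V (Suc k) \<omega>)"
      unfolding eqV using D(2) by simp
    \<comment> \<open>\<open>\<delta>\<close> is at most what \<open>cJ\<close> leaves after the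
      curvature loss. In the chain below \<open>cJ\<close> drops out and \<open>\<delta>\<close>
      remains inside \<open>\<beta>\<close>.\<close>
    have trace_le: "lmax / 2 * kf.innovation_trace k \<le> cJ - \<delta>"
      using delta[OF k] by (simp add: kf.innovation_trace_def distrib_left)
    have "m * (LINT \<omega>|\<Omega>. indicator (S k) \<omega> * V (Suc k) \<omega>)
        \<le> (LINT \<omega>|\<Omega>. indicator (S k) \<omega> * (M - h (kf.pred k \<omega>))) + lmax / 2 * kf.innovation_trace k * kf.prob (S k)"
      unfolding eqV using D(3) m by simp
    also have "\<dots> \<le> (LINT \<omega>|\<Omega>. indicator (S k) \<omega> * (m * (\<alpha> * V k \<omega> + (1 - \<alpha>)) - cJ)) + (cJ - \<delta>) * kf.prob (S k)"
    proof (intro add_mono mult_right_mono trace_le)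
      show "(LINT \<omega>|\<Omega>. indicator (S k) \<omega> * (M - h (kf.pred k \<omega>)))
          \<le> (LINT \<omega>|\<Omega>. indicator (S k) \<omega> * (m * (\<alpha> * V k \<omega> + (1 - \<alpha>)) - cJ))"
      proof (intro integral_mono_AE D(1) iV)
        show "AE \<omega> in \<Omega>. indicator (S k) \<omega> * (M - h (kf.pred k \<omega>)) \<le> indicator (S k) \<omega> * (m * (\<alpha> * V k \<omega> + (1 - \<alpha>)) - cJ)"
          using constraint
        proof eventually_elim
          case (elim \<omega>)
          then have "\<alpha> * (m * (1 - V k \<omega>)) \<le> hhat (kf.pred k \<omega>) - cJ" using k by (simp add: hV)
          then have "M - h (kf.pred k \<omega>) \<le> m * (\<alpha> * V k \<omega> + (1 - \<alpha>)) - cJ"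
            by (simp add: hhat m_def algebra_simps)
          then show ?case by (simp add: indicator_def)
        qed
      qed
    qed simp
    also have "\<dots> = (LINT \<omega>|\<Omega>. indicator (S k) \<omega> * (m * (\<alpha> * V k \<omega> + (1 - \<alpha>)) - cJ) + (cJ - \<delta>) * indicator (S k) \<omega>)"
      using iV iI SM[OF kT] by (subst Bochner_Integration.integral_add) simp_all
    also have "\<dots> = (LINT \<omega>|\<Omega>. m * (indicator (S k) \<omega> * (\<alpha> * V k \<omega> + \<beta>)))"
      using m by (intro Bochner_Integration.integral_cong) (simp_all add: \<beta>_def field_simps)
    also have "\<dots> = m * (LINT \<omega>|\<Omega>. indicator (S k) \<omega> * (\<alpha> * V k \<omega> + \<beta>))" by simp
    finally show "(LINT \<omega>|\<Omega>. indicator (S k) \<omega> * V (Suc k) \<omega>) \<le> (LINT \<omega>|\<Omega>. indicator (S k) \<omega> * (\<alpha> * V k \<omega> + \<beta>))"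
      using m by simp
  qed
  have V0: "V 0 \<omega> = v0" if "\<omega> \<in> space \<Omega>" for \<omega> using xhat_init[OF that] by (simp add: V_def v0_def)
  have ST: "S T = {\<omega> \<in> space \<Omega>. \<forall>i\<le>T. V i \<omega> \<le> 1}" by (simp add: S_def)
  note bounds = kf.exit_bounds_of_drift[of T V v0 \<alpha> \<beta>, OF Vm Vnn V0 alpha0 alpha1 drift[unfolded S_def], folded ST]
  have exit: "exit_prob \<Omega> hhat T xhat = 1 - kf.prob (S T)"
  proof -
    have "{\<omega> \<in> space \<Omega>. (MIN k\<in>{0..T}. hhat (xhat k \<omega>)) < 0} = space \<Omega> - S T"
      by (auto simp: Min_less_iff hhat_neg S_def)
    then show ?thesis using kf.prob_compl[OF SM[of T]] by (simp add: exit_prob_def)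
  qed
  have v0_eq: "v0 = (m - hhat xhat0) / m" "1 - v0 = hhat xhat0 / m" "1 - \<beta> = (m * \<alpha> + \<delta>) / m"
    "\<beta> = (m * (1 - \<alpha>) - \<delta>) / m"
    using m by (simp_all add: v0_def \<beta>_def hhat m_def field_simps)
  have "exit_prob \<Omega> hhat T xhat
           \<le> ((M - h_marg - hhat xhat0) / (M - h_marg)) * \<alpha> ^ T
             + ((M - h_marg) * (1 - \<alpha>) - \<delta>) / (M - h_marg) * (\<Sum>i=1..T. \<alpha> ^ (i - 1))" if "\<delta> < 0"
  proof -
    \<comment> \<open>The sign of \<open>\<delta>\<close> is that of
      \<open>1 - \<alpha> - \<beta>\<close>, which selects the exit bound.\<close>
    have "1 \<le> \<alpha> + \<beta>" using that m by (simp add: \<beta>_def divide_le_0_iff)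
    moreover have "(\<Sum>i=1..T. \<alpha> ^ (i - 1)) = (\<Sum>i<T. \<alpha> ^ i)"
      using sum.atLeast1_atMost_eq[of "\<lambda>i. \<alpha> ^ (i - 1)" T] by simp
    ultimately show ?thesis
      using bounds(2) unfolding exit m_def[symmetric] v0_eq(1)[symmetric] v0_eq(4)[symmetric] by simp
  qed
  moreover have "exit_prob \<Omega> hhat T xhat
           \<le> 1 - hhat xhat0 / (M - h_marg) * (((M - h_marg) * \<alpha> + \<delta>) / (M - h_marg)) ^ T" if "\<delta> \<ge> 0"
  proof -
    have "\<alpha> + \<beta> \<le> 1" using that m by (simp add: \<beta>_def)
    then show ?thesis
      using bounds(1) unfolding exit m_def[symmetric] v0_eq(2)[symmetric] v0_eq(3)[symmetric] by simp
  qed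
  moreover have "safety_prob \<Omega> h T x \<ge> 1 - exit_prob \<Omega> hhat T xhat - \<sigma>"
  proof -
    have cont: "continuous_on UNIV h"
      using h_C2 unfolding twice_continuously_differentiable_def
      by (auto intro!: continuous_at_imp_continuous_on differentiable_imp_continuous_within)
    have xm [measurable]: "x k \<in> borel_measurable \<Omega>" "xhat k \<in> borel_measurable \<Omega>" if "k \<in> {0..T}" for k
      using that kf.x_measurable[of k] kf.xhat_measurable[of k] by auto
    define E where "E = {\<omega> \<in> space \<Omega>. \<forall>k\<in>{0..T}. norm (x k \<omega> - xhat k \<omega>) \<le> \<gamma>}"
    define X where "X = {\<omega> \<in> space \<Omega>. \<exists>k\<in>{0..T}. h (x k \<omega>) < 0}"
    have [measurable]: "E \<in> sets \<Omega>" "X \<in> sets \<Omega>" unfolding E_def X_def by measurable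
    note [measurable] = SM[OF order_refl]
    have E: "{\<omega> \<in> space \<Omega>. (SUP k\<in>{0..T}. norm (x k \<omega> - xhat k \<omega>)) \<le> \<gamma>} = E"
      unfolding E_def by (subst cSUP_le_iff) auto
    have X: "{\<omega> \<in> space \<Omega>. (MIN k\<in>{0..T}. h (x k \<omega>)) < 0} = X"
      by (auto simp: Min_less_iff X_def)
    \<comment> \<open>An unsafe path either drives the estimate out of the superlevel set of
      \<open>hhat\<close> or violates the error bound, up to a null set.\<close>
    have "AE \<omega> in \<Omega>. \<omega> \<in> X \<longrightarrow> \<omega> \<in> (space \<Omega> - S T) \<union> (space \<Omega> - E)"
      using hhat_nondeg
    proof eventually_elim
      case (elim \<omega>)
      show ?case
      proof (rule impI, rule ccontr)
        assume "\<omega> \<in> X" and "\<omega> \<notin> (space \<Omega> - S T) \<union> (space \<Omega> - E)"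
        then have \<omega>: "\<omega> \<in> S T" and "\<omega> \<in> E" by (auto simp: X_def)
        obtain k where k: "k \<le> T" "h (x k \<omega>) < 0" using \<open>\<omega> \<in> X\<close> by (auto simp: X_def)
        have near: "norm (x k \<omega> - xhat k \<omega>) \<le> \<gamma>" using \<open>\<omega> \<in> E\<close> k by (auto simp: E_def)
        have "h_margin h \<gamma> \<le> h (xhat k \<omega>)"
          using \<omega> k(1) hhat_neg[of k \<omega>] by (simp add: S_def hhat h_marg not_less)
        \<comment> \<open>The estimate plays the point above the margin, the true state the unsafe
          one; the zero between them contradicts nondegeneracy.\<close>
        then obtain q where "h q = 0" "norm (xhat k \<omega> - q) < \<gamma>" "h (xhat k \<omega>) = h_margin h \<gamma>"
          using zero_near_margin_crossing[OF cont h_le_M gamma h_zero near _ k(2)] by blast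
        then show False using elim k(1) by (auto simp: hhat h_marg)
      qed
    qed
    then have "kf.prob X \<le> kf.prob ((space \<Omega> - S T) \<union> (space \<Omega> - E))"
      by (intro kf.finite_measure_mono_AE) auto
    also have "\<dots> \<le> kf.prob (space \<Omega> - S T) + kf.prob (space \<Omega> - E)"
      by (intro measure_Un_le) auto
    also have "\<dots> \<le> (1 - kf.prob (S T)) + \<sigma>"
      using sigma_gamma unfolding E by (simp add: kf.prob_compl)
    finally show ?thesis unfolding safety_prob_def exit unfolding exit_prob_def X by simp
  qed
  ultimately show ?thesis by blast
qed

end
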